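(* For every $k\ge0$ and every $\omega\in\mathbb{C}$ with $\omega^k=1$ ($\omega=1$ if $k=0$), $V^{k,\omega}$, with the inner product described in the context, is an irreducible Hilbert $\mathsf{AP}$-module of weight $k$. Moreover, any irreducible Hilbert $\mathsf{AP}$-module of weight $k$ is isomorphic to some $V^{k,\omega}$.
   Context: Annular planar rook category $\mathsf{AP}$: objects $[n]$, $n\ge0$. $\mathsf{AP}(m,n)$ is the complex vector space spanned by isotopy classes of annular tangles with $m$ marked points on the inner boundary and $n$ on the outer boundary, each boundary circle having a distinguished interval marked $\star$ (points are numbered clockwise from $\star$); each marked point is on exactly one string, each string meets one or two marked points, strings do not intersect, and no string joins two inner or two outer points. A string is a through string (joins an inner and an outer point), a cap (meets only an inner point) or a cup (meets only an outer point). Isotopies may move the boundaries (carrying points and $\star$), so a full rotation is trivial and a tangle is determined by its through-string matching: tangles from $m$ to $n$ correspond to the partial injections $\{1,\dots,m\}\rightharpoonup\{1,\dots,n\}$ that preserve cyclic order. Composition is the bilinear extension of inserting annuli (matching points and $\star$'s) and removing floating strings, i.e. composition of partial injections; the adjoint is the conjugate-linear extension of turning the tangle inside out. $\mathsf{AP}_k=\mathsf{AP}(k,k)$, and $\tau\in\mathsf{AP}_k$ is the one-click rotation sending inner point $i$ to outer point $i+1$ mod $k$ ($\tau=\mathrm{id}$ if $k=0$). A Hilbert $\mathsf{AP}$-module is a $\mathbb{C}$-linear $*$-functor $V$ from $\mathsf{AP}$ to finite dimensional complex Hilbert spaces and linear maps, $V_n=V([n])$; so $\langle c\xi,\eta\rangle=\langle\xi,c^*\eta\rangle$.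 It is irreducible if it is nonzero and has no proper nonzero submodules (any nonzero element of any $V_m$ generates $V$). Its weight is the least $n$ with $V_n\ne(0)$. Isomorphism means isomorphism of Hilbert modules (a natural family of unitaries). Definition of $V^{k,\omega}$: let $\mathsf{AI}(k,m)\subset\mathsf{AP}(k,m)$ be the span of tangles with fewer than $k$ through strings, $\mathsf{AI}_k=\mathsf{AI}(k,k)$. Then $\mathsf{AP}(m,n)$ acts by left composition $\mathsf{AP}(k,m)/\mathsf{AI}(k,m)\to\mathsf{AP}(k,n)/\mathsf{AI}(k,n)$, commuting with internal rotation $v\mapsto v\circ\tau$. $V^{k,\omega}_m$ is the $\omega$-eigenspace of the internal rotation on $\mathsf{AP}(k,m)/\mathsf{AI}(k,m)$. Inner product: $\mathsf{AP}_k/\mathsf{AI}_k\cong\mathbb{C}[\mathbb{Z}/k]$, generated by the image of $\tau$ (it is $\mathbb{C}$ if $k=0$). Let $\mathrm{tr}$ be a faithful (positive) trace on it, extended to $\mathsf{AP}_k$ via the quotient map; for $a,b\in\mathsf{AP}(k,m)$ set $\langle a,b\rangle_m=\mathrm{tr}(b^*a)$, which descends to $\mathsf{AP}(k,m)/\mathsf{AI}(k,m)$ and restricts to $V^{k,\omega}_m$. *)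

theory Defs
  imports Complex_Main "HOL-Algebra.Module" "HOL-Algebra.QuotRing"
    "HOL-Library.Poly_Mapping" "HOL-Library.Nonpos_Ints"
begin

section \<open>Annular planar rook tangles\<close>

text \<open>
  A tangle is determined up to isotopy by its through-string matching.  It is therefore encoded as
  the graph of a partial injection from the inner points to the outer points: a pair (i, j) is a
  through string from inner point i to outer point j, an inner point outside the domain
  carries a cap, and an outer point outside the range carries a cup.
\<close>

type_synonym tangle = "(nat \<times> nat) set"

definition cyc :: "nat \<Rightarrow> nat \<Rightarrow> nat \<Rightarrow> bool" where
  "cyc a b c \<longleftrightarrow> (a < b \<and> b < c) \<or> (b < c \<and> c < a) \<or> (c < a \<and> a < b)"

definition tangles :: "nat \<Rightarrow> nat \<Rightarrow> tangle set" where
  "tangles m n =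
    {t. t \<subseteq> {1..m} \<times> {1..n} \<and> single_valued t \<and> single_valued (t\<inverse>) \<and>
        (\<forall>a a' b b' c c'. (a, a') \<in> t \<longrightarrow> (b, b') \<in> t \<longrightarrow> (c, c') \<in> t \<longrightarrow>
           cyc a b c \<longrightarrow> cyc a' b' c')}"

definition rotation :: "nat \<Rightarrow> tangle" where
  "rotation k = {(i, i mod k + 1) | i. i \<in> {1..k}}"


section \<open>The category\<close>

text \<open>
  The same relation may be a tangle for several pairs (m, n), so morphism spaces (and later the
  action on modules) always carry their source and target explicitly.
\<close>

type_synonym ap = "tangle \<Rightarrow>\<^sub>0 complex"

abbreviation tangle_elem :: "tangle \<Rightarrow> ap" where
  "tangle_elem t \<equiv> Poly_Mapping.single t 1"

text \<open>
  Relational composition is written diagrammatically, hence the swap: the morphism g after f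
  is given on tangles by s O t, with s from f (inside) and t from g (outside).
\<close>

definition ap_comp :: "ap \<Rightarrow> ap \<Rightarrow> ap" (infixl \<open>\<circ>\<^sub>A\<close> 70) where
  "g \<circ>\<^sub>A f =
    (\<Sum>s\<in>Poly_Mapping.keys f. \<Sum>t\<in>Poly_Mapping.keys g.
       Poly_Mapping.single (s O t) (Poly_Mapping.lookup g t * Poly_Mapping.lookup f s))"

definition ap_adj :: "ap \<Rightarrow> ap" where
  "ap_adj f =
    (\<Sum>t\<in>Poly_Mapping.keys f. Poly_Mapping.single (t\<inverse>) (cnj (Poly_Mapping.lookup f t)))"

definition ap_id :: "nat \<Rightarrow> ap" where
  "ap_id n = tangle_elem (Id_on {1..n})"

definition ap_tau :: "nat \<Rightarrow> ap" where
  "ap_tau k = tangle_elem (rotation k)"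

definition complex_ring :: "complex ring" where
  "complex_ring = \<lparr>carrier = UNIV, mult = (*), one = 1, zero = 0, add = (+)\<rparr>"

text \<open>
  The fields \<^const>\<open>mult\<close> and \<^const>\<open>one\<close> are only meaningful for m = n, where they make the
  endomorphism space into the algebra of endomorphisms of [n].
\<close>

definition AP :: "nat \<Rightarrow> nat \<Rightarrow> (complex, ap) module" where
  "AP m n = \<lparr>carrier = {f. Poly_Mapping.keys f \<subseteq> tangles m n}, mult = (\<circ>\<^sub>A), one = ap_id n,
             zero = 0, add = (+), smult = (\<lambda>c. Poly_Mapping.map ((*) c))\<rparr>"

text \<open>In the next definition k is both the source object and the bound on through strings.\<close>

definition AI :: "nat \<Rightarrow> nat \<Rightarrow> ap set" where
  "AI k m = {f. Poly_Mapping.keys f \<subseteq> {t \<in> tangles k m. card t < k}}"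


section \<open>Hilbert modules\<close>

record 'v hspace = "(complex, 'v) module" +
  ip :: "'v \<Rightarrow> 'v \<Rightarrow> complex"

text \<open>Inner products are linear in the first variable. Completeness is automatic.\<close>

locale fd_hilbert_space = Module.module complex_ring H for H :: "'v hspace" (structure) +
  assumes ip_add: "\<lbrakk>x \<in> carrier H; y \<in> carrier H; z \<in> carrier H\<rbrakk> \<Longrightarrow>
      ip H (x \<oplus>\<^bsub>H\<^esub> y) z = ip H x z + ip H y z"
    and ip_smult: "\<lbrakk>x \<in> carrier H; y \<in> carrier H\<rbrakk> \<Longrightarrow> ip H (c \<odot>\<^bsub>H\<^esub> x) y = c * ip H x y"
    and ip_cnj: "\<lbrakk>x \<in> carrier H; y \<in> carrier H\<rbrakk> \<Longrightarrow> ip H y x = cnj (ip H x y)"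
    and ip_nonneg: "x \<in> carrier H \<Longrightarrow> ip H x x \<in> \<real>\<^sub>\<ge>\<^sub>0"
    and ip_definite: "\<lbrakk>x \<in> carrier H; ip H x x = 0\<rbrakk> \<Longrightarrow> x = \<zero>\<^bsub>H\<^esub>"
    and finite_dim: "\<exists>B. finite B \<and> B \<subseteq> carrier H \<and>
      (\<forall>x\<in>carrier H. \<exists>c. x = (\<Oplus>\<^bsub>H\<^esub>b\<in>B. c b \<odot>\<^bsub>H\<^esub> b))"

definition linear_maps :: "('r, 'v, 'm) module_scheme \<Rightarrow> ('r, 'w, 'n) module_scheme \<Rightarrow> ('v \<Rightarrow> 'w) set"
  where "linear_maps M N = {f \<in> carrier M \<rightarrow> carrier N.
    (\<forall>x\<in>carrier M. \<forall>y\<in>carrier M. f (x \<oplus>\<^bsub>M\<^esub> y) = f x \<oplus>\<^bsub>N\<^esub> f y) \<and>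
    (\<forall>c. \<forall>x\<in>carrier M. f (c \<odot>\<^bsub>M\<^esub> x) = c \<odot>\<^bsub>N\<^esub> f x)}"

record 'v ap_module =
  space :: "nat \<Rightarrow> 'v hspace"
  act :: "nat \<Rightarrow> nat \<Rightarrow> ap \<Rightarrow> 'v \<Rightarrow> 'v"

locale hilbert_ap_module =
  fixes V :: "'v ap_module"
  assumes hilbert: "fd_hilbert_space (space V n)"
    and act_linear: "a \<in> carrier (AP m n) \<Longrightarrow> act V m n a \<in> linear_maps (space V m) (space V n)"
    and act_add: "\<lbrakk>a \<in> carrier (AP m n); b \<in> carrier (AP m n); x \<in> carrier (space V m)\<rbrakk> \<Longrightarrow>
      act V m n (a \<oplus>\<^bsub>AP m n\<^esub> b) x = act V m n a x \<oplus>\<^bsub>space V n\<^esub> act V m n b x"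
    and act_smult: "\<lbrakk>a \<in> carrier (AP m n); x \<in> carrier (space V m)\<rbrakk> \<Longrightarrow>
      act V m n (c \<odot>\<^bsub>AP m n\<^esub> a) x = c \<odot>\<^bsub>space V n\<^esub> act V m n a x"
    and act_id: "x \<in> carrier (space V n) \<Longrightarrow> act V n n (ap_id n) x = x"
    and act_comp: "\<lbrakk>a \<in> carrier (AP l m); b \<in> carrier (AP m n); x \<in> carrier (space V l)\<rbrakk> \<Longrightarrow>
      act V l n (b \<circ>\<^sub>A a) x = act V m n b (act V l m a x)"
    and act_adj: "\<lbrakk>a \<in> carrier (AP m n); x \<in> carrier (space V m); y \<in> carrier (space V n)\<rbrakk> \<Longrightarrow>
      ip (space V n) (act V m n a x) y = ip (space V m) x (act V n m (ap_adj a) y)"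

definition ap_submodule :: "(nat \<Rightarrow> 'v set) \<Rightarrow> 'v ap_module \<Rightarrow> bool" where
  "ap_submodule W V \<longleftrightarrow>
    (\<forall>n. submodule (W n) complex_ring (space V n)) \<and>
    (\<forall>m n. \<forall>a\<in>carrier (AP m n). \<forall>x\<in>W m. act V m n a x \<in> W n)"

definition irreducible_ap_module :: "'v ap_module \<Rightarrow> bool" where
  "irreducible_ap_module V \<longleftrightarrow> hilbert_ap_module V \<and>
    (\<exists>n. carrier (space V n) \<noteq> {\<zero>\<^bsub>space V n\<^esub>}) \<and>
    (\<forall>W. ap_submodule W V \<longrightarrow>
       (\<forall>n. W n = {\<zero>\<^bsub>space V n\<^esub>}) \<or> (\<forall>n. W n = carrier (space V n)))"

text \<open>A junk value unless the module is nonzero.\<close>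

definition weight :: "'v ap_module \<Rightarrow> nat" where
  "weight V = (LEAST n. carrier (space V n) \<noteq> {\<zero>\<^bsub>space V n\<^esub>})"

definition unitaries :: "'v hspace \<Rightarrow> 'w hspace \<Rightarrow> ('v \<Rightarrow> 'w) set" where
  "unitaries H K = {u \<in> linear_maps H K. bij_betw u (carrier H) (carrier K) \<and>
    (\<forall>x\<in>carrier H. \<forall>y\<in>carrier H. ip K (u x) (u y) = ip H x y)}"

definition ap_module_iso :: "'v ap_module \<Rightarrow> 'w ap_module \<Rightarrow> bool" where
  "ap_module_iso V W \<longleftrightarrow> (\<exists>u. (\<forall>n. u n \<in> unitaries (space V n) (space W n)) \<and>
    (\<forall>m n. \<forall>a\<in>carrier (AP m n). \<forall>x\<in>carrier (space V m).
       u n (act V m n a x) = act W m n a (u m x)))"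


section \<open>Quotients\<close>

text \<open>The map into the quotient by N' induced by f, where N' is a subgroup of M'.\<close>

definition quot_map :: "('w, 'm) ring_scheme \<Rightarrow> 'w set \<Rightarrow> ('v \<Rightarrow> 'w) \<Rightarrow> 'v set \<Rightarrow> 'w set" where
  "quot_map M' N' f X = (\<Union>x\<in>X. N' +>\<^bsub>M'\<^esub> f x)"

text \<open>
  The quotient ring \<^const>\<open>FactRing\<close> together with scalar multiplication.  As before, the
  multiplicative fields are only meaningful if M is an algebra and N an ideal.
\<close>

definition quot_module :: "('r, 'v, 'm) module_scheme \<Rightarrow> 'v set \<Rightarrow> ('r, 'v set) module" where
  "quot_module M N =
    \<lparr>carrier = carrier (M Quot N), mult = mult (M Quot N), one = one (M Quot N),
     zero = zero (M Quot N), add = add (M Quot N),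
     smult = (\<lambda>c. quot_map M N (\<lambda>x. c \<odot>\<^bsub>M\<^esub> x))\<rparr>"

abbreviation APQ :: "nat \<Rightarrow> nat \<Rightarrow> (complex, ap set) module" where
  "APQ k m \<equiv> quot_module (AP k m) (AI k m)"

definition faithful_trace :: "nat \<Rightarrow> (ap set \<Rightarrow> complex) \<Rightarrow> bool" where
  "faithful_trace k tr \<longleftrightarrow>
    (let Q = APQ k k; star = quot_map (AP k k) (AI k k) ap_adj in
      (\<forall>X\<in>carrier Q. \<forall>Y\<in>carrier Q. tr (X \<oplus>\<^bsub>Q\<^esub> Y) = tr X + tr Y) \<and>
      (\<forall>c. \<forall>X\<in>carrier Q. tr (c \<odot>\<^bsub>Q\<^esub> X) = c * tr X) \<and>
      (\<forall>X\<in>carrier Q. \<forall>Y\<in>carrier Q. tr (X \<otimes>\<^bsub>Q\<^esub> Y) = tr (Y \<otimes>\<^bsub>Q\<^esub> X)) \<and>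
      (\<forall>X\<in>carrier Q. tr (star X \<otimes>\<^bsub>Q\<^esub> X) \<in> \<real>\<^sub>\<ge>\<^sub>0) \<and>
      (\<forall>X\<in>carrier Q. tr (star X \<otimes>\<^bsub>Q\<^esub> X) = 0 \<longrightarrow> X = \<zero>\<^bsub>Q\<^esub>))"


section \<open>The modules $V^{k,\omega}$\<close>

text \<open>Here tr is extended to the algebra of endomorphisms of [k] along the quotient map.\<close>

definition trace_form :: "nat \<Rightarrow> (ap set \<Rightarrow> complex) \<Rightarrow> ap \<Rightarrow> ap \<Rightarrow> complex" where
  "trace_form k tr a b = tr (AI k k +>\<^bsub>AP k k\<^esub> (ap_adj b \<circ>\<^sub>A a))"

definition Vmod_space :: "nat \<Rightarrow> complex \<Rightarrow> (ap set \<Rightarrow> complex) \<Rightarrow> nat \<Rightarrow> ap set hspace" where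
  "Vmod_space k \<omega> tr m =
    \<lparr>carrier = {X \<in> carrier (APQ k m).
        quot_map (AP k m) (AI k m) (\<lambda>v. v \<circ>\<^sub>A ap_tau k) X = \<omega> \<odot>\<^bsub>APQ k m\<^esub> X},
     mult = mult (APQ k m), one = one (APQ k m), zero = zero (APQ k m), add = add (APQ k m),
     smult = smult (APQ k m),
     ip = (\<lambda>X Y. THE z. \<forall>a\<in>X. \<forall>b\<in>Y. z = trace_form k tr a b)\<rparr>"

definition Vmod :: "nat \<Rightarrow> complex \<Rightarrow> (ap set \<Rightarrow> complex) \<Rightarrow> ap set ap_module" where
  "Vmod k \<omega> tr =
    \<lparr>space = Vmod_space k \<omega> tr,
     act = (\<lambda>m n c. quot_map (AP k n) (AI k n) (\<lambda>v. c \<circ>\<^sub>A v))\<rparr>"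

end

theory Submission
  imports Defs
begin

text \<open>
  A tangle with all k through strings is a cyclically monotone injection, so the full tangles from
  [k] to [k] are exactly the rotations, and the space of morphisms modulo lower ones has the full
  tangles as a basis.  Let e be the sum of the rotations \<open>\<tau>\<^sup>j\<close> weighted by \<open>\<omega>\<^sup>-\<^sup>j\<close>.
  Every \<open>\<omega>\<close>-eigenvector h of the internal rotation on endomorphisms of [k] is congruent to h(id) e,
  where h(id) is the coefficient of the identity; hence the trace form on the eigenspace is a positive
  multiple, tr e, of the standard inner product on coefficients.  Composing an eigenvector a with the
  adjoint of a tangle t on which a is nonzero gives a nonzero multiple of e, and
  e generates, whence irreducibility.

  Conversely, let U be irreducible of weight k.  A tangle with fewer than k through strings factors
  through a smaller object, so it kills \<open>U\<^sub>k\<close>.  Some e moves a given nonzero vector to a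
  nonzero vector \<open>\<xi>\<close>, and sending the class of f to \<open>f \<xi>\<close> is, after rescaling \<open>\<xi>\<close>, isometric,
  because both inner products depend only on the coefficient of the identity in \<open>g\<^sup>* f\<close>.
  Its image is a nonzero submodule.
\<close>

section \<open>Tangles and rotations\<close>

lemma tangles_comp:
  assumes s: "s \<in> tangles l m" and t: "t \<in> tangles m n"
  shows "s O t \<in> tangles l n"
proof -
  have "s O t \<subseteq> {1..l} \<times> {1..n}"
    using s t unfolding tangles_def by blast
  moreover have "single_valued (s O t)"
    using s t unfolding tangles_def by (blast intro: single_valued_relcomp)
  moreover have "single_valued ((s O t)\<inverse>)"
    using s t unfolding tangles_def converse_relcomp by (blast intro: single_valued_relcomp)
  moreover have "cyc a' b' c'"
    if abc: "(a, a') \<in> s O t" "(b, b') \<in> s O t" "(c, c') \<in> s O t" "cyc a b c" for a a' b b' c c'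
  proof -
    obtain a1 b1 c1 where s1: "(a, a1) \<in> s" "(b, b1) \<in> s" "(c, c1) \<in> s"
      and t1: "(a1, a') \<in> t" "(b1, b') \<in> t" "(c1, c') \<in> t"
      using abc(1-3) by blast
    have "cyc a1 b1 c1" using s s1 abc(4) unfolding tangles_def by blast
    then show ?thesis using t t1 unfolding tangles_def by blast
  qed
  ultimately show ?thesis unfolding tangles_def by blast
qed

text \<open>Three distinct points satisfy exactly one of the two cyclic orders. If the inner ends
  were ordered the other way round, preservation by \<open>t\<close> would order the outer ends the
  other way round as well.\<close>

lemma tangles_converse:
  assumes t: "t \<in> tangles m n"
  shows "t\<inverse> \<in> tangles n m"
proof -
  have t1: "t \<subseteq> {1..m} \<times> {1..n}" "single_valued t" "single_valued (t\<inverse>)"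
    and t2: "\<And>a a' b b' c c'. (a, a') \<in> t \<Longrightarrow> (b, b') \<in> t \<Longrightarrow> (c, c') \<in> t \<Longrightarrow>
      cyc a b c \<Longrightarrow> cyc a' b' c'"
    using t unfolding tangles_def by blast+
  have "cyc a b c"
    if abc: "(a, a') \<in> t" "(b, b') \<in> t" "(c, c') \<in> t" "cyc a' b' c'" for a a' b b' c c'
  proof -
    have "a' \<noteq> b'" "b' \<noteq> c'" "a' \<noteq> c'" using abc(4) by (auto simp: cyc_def)
    then have "a \<noteq> b" "b \<noteq> c" "a \<noteq> c"
      using abc(1-3) t1(2) unfolding single_valued_def by metis+
    moreover have "\<not> cyc a' c' b'" using abc(4) by (auto simp: cyc_def)
    then have "\<not> cyc a c b" using t2[OF abc(1) abc(3) abc(2)] by blast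
    ultimately show ?thesis unfolding cyc_def by (metis linorder_neqE_nat)
  qed
  then show ?thesis unfolding tangles_def using t1 by auto
qed

lemma finite_tangles: "finite (tangles m n)"
  by (rule finite_subset[of _ "Pow ({1..m} \<times> {1..n})"]) (auto simp: tangles_def)

lemma finite_tangle: "t \<in> tangles m n \<Longrightarrow> finite t"
  by (rule finite_subset[of _ "{1..m} \<times> {1..n}"]) (auto simp: tangles_def)

lemma card_tangle_Domain: "t \<in> tangles m n \<Longrightarrow> card (Domain t) = card t"
  unfolding fst_eq_Domain[symmetric]
  by (rule card_image) (auto simp: tangles_def inj_on_def dest: single_valuedD)

lemma card_comp_le_left:
  assumes s: "s \<in> tangles l m" and t: "t \<in> tangles m n"
  shows "card (s O t) \<le> card s"
proof -
  have "finite (Domain s)" using finite_tangle[OF s] by (rule finite_Domain)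
  then have "card (Domain (s O t)) \<le> card (Domain s)"
    by (rule card_mono) blast
  then show ?thesis
    using card_tangle_Domain[OF s] card_tangle_Domain[OF tangles_comp[OF s t]] by simp
qed

text \<open>Turning both tangles inside out exchanges the two factors.\<close>

lemma card_comp_le_right:
  assumes s: "s \<in> tangles l m" and t: "t \<in> tangles m n"
  shows "card (s O t) \<le> card t"
  using card_comp_le_left[OF tangles_converse[OF t] tangles_converse[OF s]]
  by (simp add: converse_relcomp[symmetric])

lemma card_tangle_le:
  assumes t: "t \<in> tangles m n"
  shows "card t \<le> m" "card t \<le> n"
proof -
  have *: "card s \<le> p" if "s \<in> tangles p q" for s p q
  proof -
    have "card (Domain s) \<le> card {1..p}"
      using that by (intro card_mono) (auto simp: tangles_def)
    then show ?thesis using card_tangle_Domain[OF that] by simp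
  qed
  show "card t \<le> m" using *[OF t] .
  show "card t \<le> n" using *[OF tangles_converse[OF t]] by simp
qed

lemma Id_on_tangles: "A \<subseteq> {1..n} \<Longrightarrow> Id_on A \<in> tangles n n"
  by (auto simp: tangles_def single_valued_def)

text \<open>The first factor relabels the inner ends of \<open>t\<close> by their rank
  \<open>p\<close> and caps off the other inner points; it is increasing, hence preserves cyclic
  order. Undoing the relabelling before \<open>t\<close> gives the second factor. Thus a tangle with
  few through strings passes through a small object.\<close>

lemma tangles_factor:
  assumes t: "t \<in> tangles m n"
  obtains s r where "s \<in> tangles m (card t)" "r \<in> tangles (card t) n" "t = s O r"
proof -
  define D where "D = Domain t"
  define p where "p d = card {x \<in> D. x \<le> d}" for d
  define s where "s = {(d, p d) | d. d \<in> D}"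
  have fD: "finite D" unfolding D_def using finite_tangle[OF t] by (rule finite_Domain)
  have cD: "card D = card t" unfolding D_def by (rule card_tangle_Domain[OF t])
  have Dm: "D \<subseteq> {1..m}" using t by (auto simp: D_def tangles_def)
  have mono: "p a < p b" if "a < b" "b \<in> D" for a b
    unfolding p_def using that fD
    by (intro psubset_card_mono) (auto simp: psubset_eq set_eq_iff not_le intro!: exI[of _ b])
  have inj: "a = b" if "p a = p b" "a \<in> D" "b \<in> D" for a b
    using mono[of a b] mono[of b a] that by (cases a b rule: linorder_cases) auto
  have bnd: "p d \<in> {1..card t}" if "d \<in> D" for d
  proof -
    have "p d \<le> card D" unfolding p_def by (intro card_mono fD) auto
    moreover have "p d > 0" unfolding p_def using that fD by (auto simp: card_gt_0_iff)
    ultimately show ?thesis using cD by simp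
  qed
  have s: "s \<in> tangles m (card t)"
    unfolding tangles_def
  proof (intro CollectI conjI)
    show "s \<subseteq> {1..m} \<times> {1..card t}" using Dm bnd by (auto simp: s_def)
    show "single_valued s" by (auto simp: s_def single_valued_def)
    show "single_valued (s\<inverse>)" using inj by (auto simp: s_def single_valued_def)
    show "\<forall>a a' b b' c c'. (a, a') \<in> s \<longrightarrow> (b, b') \<in> s \<longrightarrow> (c, c') \<in> s \<longrightarrow>
        cyc a b c \<longrightarrow> cyc a' b' c'"
      using mono by (auto simp: s_def cyc_def)
  qed
  have "s O s\<inverse> = Id_on D" using inj by (auto simp: s_def)
  then have "s O (s\<inverse> O t) = t"
    by (auto simp: O_assoc[symmetric] D_def)
  then show thesis
    using that[OF s tangles_comp[OF tangles_converse[OF s] t]] by simp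
qed

section \<open>Rotations\<close>

text \<open>The power \<tau>^j. The shifts by 1 pass between points numbered from 1 and residues;
  \<open>j\<close> is not reduced modulo \<open>k\<close>, so that exponents simply add under
  composition. For \<open>k = 0\<close> it is the empty tangle.\<close>

definition rot :: "nat \<Rightarrow> nat \<Rightarrow> tangle" where
  "rot k j = {(i, (i - 1 + j) mod k + 1) | i. i \<in> {1..k}}"

lemma rot_0: "rot k 0 = Id_on {1..k}"
  by (auto simp: rot_def)

lemma rot_1: "rot k 1 = rotation k"
  by (auto simp: rot_def rotation_def)

lemma rot_self: "rot k k = Id_on {1..k}"
  by (auto simp: rot_def)

lemma rot_comp: "rot k i O rot k j = rot k (i + j)"
proof -
  have *: "(((a - 1 + i) mod k + 1) - 1 + j) mod k + 1 = (a - 1 + (i + j)) mod k + 1" for a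
    by (simp only: diff_add_inverse2 mod_add_left_eq add.assoc)
  show ?thesis
  proof (intro equalityI subrelI)
    fix a c assume "(a, c) \<in> rot k i O rot k j"
    then obtain b where ab: "(a, b) \<in> rot k i" and bc: "(b, c) \<in> rot k j" by blast
    have a: "a \<in> {1..k}" and b: "b = (a - 1 + i) mod k + 1" using ab by (auto simp: rot_def)
    have "c = (b - 1 + j) mod k + 1" using bc by (auto simp: rot_def)
    then have "c = (a - 1 + (i + j)) mod k + 1" unfolding b * .
    then show "(a, c) \<in> rot k (i + j)" using a by (auto simp: rot_def)
  next
    fix a b assume "(a, b) \<in> rot k (i + j)"
    then have a: "a \<in> {1..k}" and b: "b = (a - 1 + (i + j)) mod k + 1" by (auto simp: rot_def)
    have "(a, (a - 1 + i) mod k + 1) \<in> rot k i" using a by (auto simp: rot_def)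
    moreover have "(a - 1 + i) mod k + 1 \<in> {1..k}" using a by (simp add: Suc_le_eq)
    then have "((a - 1 + i) mod k + 1, b) \<in> rot k j" unfolding rot_def b *[symmetric] by blast
    ultimately show "(a, b) \<in> rot k i O rot k j" by blast
  qed
qed

lemma rotation_tangles: "rotation k \<in> tangles k k"
proof -
  \<comment> \<open>Only the point \<open>k\<close> wraps around; this form of the remainder reduces
    all conditions to comparisons of numbers.\<close>
  have mod: "i mod k = (if i = k then 0 else i)" if "i \<le> k" for i
    using that by auto
  show ?thesis
    unfolding tangles_def
  proof (intro CollectI conjI)
    show "rotation k \<subseteq> {1..k} \<times> {1..k}" by (auto simp: rotation_def mod)
    show "single_valued (rotation k)" by (auto simp: rotation_def single_valued_def)
    show "single_valued ((rotation k)\<inverse>)"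
      by (auto simp: rotation_def single_valued_def mod split: if_splits)
    show "\<forall>a a' b b' c c'. (a, a') \<in> rotation k \<longrightarrow> (b, b') \<in> rotation k \<longrightarrow>
        (c, c') \<in> rotation k \<longrightarrow> cyc a b c \<longrightarrow> cyc a' b' c'"
      by (auto simp: rotation_def cyc_def mod split: if_splits)
  qed
qed

lemma rot_tangles: "rot k j \<in> tangles k k"
proof (induction j)
  case 0
  then show ?case by (simp add: rot_0 Id_on_tangles)
next
  case (Suc j)
  then show ?case
    using tangles_comp[OF Suc rotation_tangles] by (simp add: rot_1[symmetric] rot_comp)
qed

lemma card_rot: "card (rot k j) = k"
proof -
  have "Domain (rot k j) = {1..k}" by (auto simp: rot_def)
  then show ?thesis using card_tangle_Domain[OF rot_tangles[of k j]] by simp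
qed

text \<open>\<open>rot k j\<close> has \<open>k\<close> strings, so its range consists of all
  \<open>k\<close> points and it can be undone. Hence precomposition with a rotation is injective on
  tangles.\<close>

lemma rot_cancel:
  assumes t: "t \<in> tangles k m"
  shows "(rot k j)\<inverse> O (rot k j O t) = t"
proof -
  have "Range (rot k j) = {1..k}"
  proof -
    have "card (Domain ((rot k j)\<inverse>)) = k"
      using card_tangle_Domain[OF tangles_converse[OF rot_tangles[of k j]]] by (simp add: card_rot)
    moreover have "Range (rot k j) \<subseteq> {1..k}" using rot_tangles[of k j] by (auto simp: tangles_def)
    ultimately show ?thesis by (intro card_subset_eq) auto
  qed
  moreover have "single_valued (rot k j)" using rot_tangles[of k j] by (auto simp: tangles_def)
  ultimately have "(rot k j)\<inverse> O rot k j = Id_on {1..k}"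
    by (auto dest: single_valuedD)
  moreover have "Id_on {1..k} O t = t" using t by (auto simp: tangles_def)
  ultimately show ?thesis by (simp add: O_assoc[symmetric])
qed

section \<open>Tangles with the maximal number of through strings\<close>

text \<open>These are the tangles from [k] to [m] that do not lie in \<open>AI k m\<close>, so their
  classes form a basis of the quotient.\<close>

definition full_tangles :: "nat \<Rightarrow> nat \<Rightarrow> tangle set" where
  "full_tangles k m = {t \<in> tangles k m. card t = k}"

lemma full_tangles_tangle: "t \<in> full_tangles k m \<Longrightarrow> t \<in> tangles k m"
  by (simp add: full_tangles_def)

lemma finite_full_tangles: "finite (full_tangles k m)"
  unfolding full_tangles_def using finite_tangles[of k m] by simp

lemma rot_full: "rot k j \<in> full_tangles k k"
  by (simp add: full_tangles_def rot_tangles card_rot)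

lemma full_tangles_Domain:
  assumes "t \<in> full_tangles k m"
  shows "Domain t = {1..k}"
  using assms card_tangle_Domain[of t k m]
  by (intro card_subset_eq) (auto simp: full_tangles_def tangles_def)

text \<open>A lost through string could not be recovered by cancelling the rotation.\<close>

lemma rot_comp_full:
  assumes t: "t \<in> full_tangles k m"
  shows "rot k j O t \<in> full_tangles k m"
proof -
  have t': "t \<in> tangles k m" using t by (rule full_tangles_tangle)
  have "card t \<le> card (rot k j O t)"
    using card_comp_le_right[OF tangles_converse[OF rot_tangles[of k j]]
        tangles_comp[OF rot_tangles[of k j] t']] rot_cancel[OF t'] by simp
  moreover have "card (rot k j O t) \<le> k"
    by (rule card_tangle_le(1)[OF tangles_comp[OF rot_tangles t']])
  ultimately show ?thesis
    using t tangles_comp[OF rot_tangles t'] by (auto simp: full_tangles_def)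
qed

text \<open>Cutting the circle at the fixed point 1 turns cyclic order into linear order, so the
  matching is a strictly increasing map of \<open>{1..k}\<close> into itself, hence the
  identity.\<close>

lemma full_tangle_fixing_1:
  assumes t: "t \<in> full_tangles k k" and 1: "(1, 1) \<in> t"
  shows "t = Id_on {1..k}"
proof -
  have "\<exists>f. \<forall>i\<in>{1..k}. (i, f i) \<in> t"
    using full_tangles_Domain[OF t] by (intro bchoice) blast
  then obtain f where f: "\<And>i. i \<in> {1..k} \<Longrightarrow> (i, f i) \<in> t" by blast
  have T: "t \<subseteq> {1..k} \<times> {1..k}" "single_valued t" "single_valued (t\<inverse>)"
    and cyc: "\<And>a a' b b' c c'. (a, a') \<in> t \<Longrightarrow> (b, b') \<in> t \<Longrightarrow> (c, c') \<in> t \<Longrightarrow>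
           cyc a b c \<Longrightarrow> cyc a' b' c'"
    using full_tangles_tangle[OF t] unfolding tangles_def by blast+
  have inj: "i = j" if "f i = f j" "i \<in> {1..k}" "j \<in> {1..k}" for i j
    using f[OF that(2)] f[OF that(3)] that(1) T(3) by (auto dest: single_valuedD)
  have rng: "f i \<in> {1..k}" if "i \<in> {1..k}" for i
    using f[OF that] T(1) by blast
  have "1 \<in> {1..k}" using 1 T(1) by blast
  then have f1: "f 1 = 1" using f[of 1] 1 T(2) by (blast dest: single_valuedD)
  have gt1: "f i > 1" if "i \<in> {2..k}" for i
    using rng[of i] inj[of i 1] that f1 by (cases "f i = 1") auto
  have mono: "f i < f j" if "1 \<le> i" "i < j" "j \<le> k" for i j
  proof (cases "i = 1")
    case True
    then show ?thesis using gt1[of j] f1 that by simp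
  next
    case False
    \<comment> \<open>Both images exceed 1, so their cyclic order relative to the fixed point 1 is
      just \<open>f i < f j\<close>.\<close>
    then have "cyc 1 (f i) (f j)"
      using cyc[OF 1 f f, of i j] that by (auto simp: cyc_def)
    then show ?thesis using gt1[of i] gt1[of j] that False by (auto simp: cyc_def)
  qed
  \<comment> \<open>Strict growth upwards from \<open>f 1 = 1\<close> gives one bound; descent from
    \<open>f k \<le> k\<close> gives the reverse bound in \<open>le\<close>.\<close>
  have ge: "Suc i \<le> k \<Longrightarrow> Suc i \<le> f (Suc i)" for i
  proof (induction i)
    case 0
    then show ?case using f1 by simp
  next
    case (Suc i)
    then show ?case using mono[of "Suc i" "Suc (Suc i)"] by simp
  qed
  have le: "d < k \<Longrightarrow> f (k - d) \<le> k - d" for d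
  proof (induction d)
    case 0
    then show ?case using rng[of k] by simp
  next
    case (Suc d)
    then have "f (k - Suc d) < f (k - d)" by (intro mono) auto
    then show ?case using Suc by linarith
  qed
  have fi: "f i = i" if "i \<in> {1..k}" for i
    using ge[of "i - 1"] le[of "k - i"] that by simp
  have "Id_on {1..k} \<subseteq> t" using f fi by force
  moreover have "t \<subseteq> Id_on {1..k}"
  proof
    fix x assume x: "x \<in> t"
    obtain a b where ab: "x = (a, b)" by fastforce
    have "a \<in> {1..k}" using x ab T(1) by blast
    then have "b = a" using f[of a] fi x ab T(2) by (auto dest: single_valuedD)
    then show "x \<in> Id_on {1..k}" using ab \<open>a \<in> {1..k}\<close> by auto
  qed
  ultimately show ?thesis by blast
qed

text \<open>Rotate the outer end of the string at 1 back to 1, recognise the identity, and rotate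
  forward again. The range is \<open>max 1 k\<close> because for \<open>k = 0\<close> there is still
  one full tangle, the empty one.\<close>

lemma full_tangles_eq_rot: "full_tangles k k = rot k ` {..<max 1 k}"
proof
  show "rot k ` {..<max 1 k} \<subseteq> full_tangles k k" using rot_full by blast
  show "full_tangles k k \<subseteq> rot k ` {..<max 1 k}"
  proof
    fix t assume t: "t \<in> full_tangles k k"
    show "t \<in> rot k ` {..<max 1 k}"
    proof (cases "k = 0")
      case True
      then have "t = {}" "rot k 0 = {}"
        using t by (auto simp: full_tangles_def tangles_def rot_def)
      then show ?thesis by (intro image_eqI[of _ _ 0]) auto
    next
      case False
      then obtain p where p: "(1, p) \<in> t" using full_tangles_Domain[OF t] by fastforce
      then have pk: "p \<in> {1..k}" using full_tangles_tangle[OF t] by (auto simp: tangles_def)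
      have tt: "t \<in> tangles k k" using t by (rule full_tangles_tangle)
      have t_id: "t O Id_on {1..k} = t" using tt by (auto simp: tangles_def)
      \<comment> \<open>Rotation by \<open>q\<close> takes \<open>p\<close> to 1, and
        \<open>q + (p - 1) = k\<close> is a full turn.\<close>
      define q where "q = k + 1 - p"
      have tback: "(t O rot k q) O rot k (p - 1) = t"
        using pk t_id rot_self[of k] by (simp add: O_assoc rot_comp q_def)
      \<comment> \<open>Composing further recovers \<open>t\<close> with its \<open>k\<close>
        strings, so none was lost before.\<close>
      have "t O rot k q \<in> full_tangles k k"
        using card_comp_le_left[OF tangles_comp[OF tt rot_tangles[of k q]] rot_tangles[of k "p - 1"]]
          card_tangle_le(1)[OF tangles_comp[OF tt rot_tangles[of k q]]] t
          tangles_comp[OF tt rot_tangles[of k q]]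
        unfolding tback by (auto simp: full_tangles_def)
      moreover have "(p, 1) \<in> rot k q"
        using pk by (auto simp: rot_def q_def)
      then have "(1, 1) \<in> t O rot k q" using p by blast
      ultimately have "t O rot k q = Id_on {1..k}" by (rule full_tangle_fixing_1)
      then have "t = rot k 0 O rot k (p - 1)" using tback by (simp only: rot_0)
      then have "t = rot k (p - 1)" by (simp only: rot_comp add_0)
      then show ?thesis using pk by (intro image_eqI[of _ _ "p - 1"]) auto
    qed
  qed
qed

lemma inj_on_rot: "inj_on (rot k) {..<max 1 k}"
proof (rule inj_onI)
  fix i j assume ij: "i \<in> {..<max 1 k}" "j \<in> {..<max 1 k}" "rot k i = rot k j"
  show "i = j"
  proof (cases "k = 0")
    case False
    moreover have "i < k" using ij(1) False by simp
    ultimately have "(1, i + 1) \<in> rot k i" by (auto simp: rot_def)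
    then have 1: "(1, i + 1) \<in> rot k j" using ij(3) by simp
    have "j < k" using ij(2) False by simp
    then show ?thesis using 1 by (auto simp: rot_def)
  qed (use ij in auto)
qed

text \<open>Going out along \<open>s\<close> and back along \<open>t\<close> fixes every inner point
  only if both send it to the same outer point. Through \<open>ap_adj\<close> this becomes
  orthonormality of the full tangles for the identity coefficient.\<close>

lemma comp_converse_eq_Id:
  assumes s: "s \<in> tangles k m" and t: "t \<in> tangles k m"
  shows "s O t\<inverse> = Id_on {1..k} \<longleftrightarrow> s = t \<and> s \<in> full_tangles k m"
proof
  assume *: "s O t\<inverse> = Id_on {1..k}"
  have sub: "u \<subseteq> v" if "u \<in> tangles k m" "v \<in> tangles k m" "u O v\<inverse> = Id_on {1..k}" for u v
  proof
    fix x assume x: "x \<in> u"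
    obtain a b where ab: "x = (a, b)" by fastforce
    have "a \<in> {1..k}" using that(1) x ab by (auto simp: tangles_def)
    then have "(a, a) \<in> u O v\<inverse>" using that(3) by auto
    then obtain c where "(a, c) \<in> u" "(a, c) \<in> v" by blast
    moreover have "single_valued u" using that(1) by (auto simp: tangles_def)
    ultimately show "x \<in> v" using x ab by (auto dest: single_valuedD)
  qed
  have "t O s\<inverse> = (s O t\<inverse>)\<inverse>" by (simp add: converse_relcomp)
  then have "t O s\<inverse> = Id_on {1..k}" using * by simp
  then have "s = t" using sub[OF s t *] sub[OF t s] by blast
  moreover have "k \<le> card s"
    using card_comp_le_left[OF s tangles_converse[OF t]] * card_rot[of k 0]
    by (simp add: rot_0)
  ultimately show "s = t \<and> s \<in> full_tangles k m"
    using s card_tangle_le(1)[OF s] by (simp add: full_tangles_def)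
next
  assume *: "s = t \<and> s \<in> full_tangles k m"
  have "single_valued (s\<inverse>)" using s by (auto simp: tangles_def)
  then have "s O s\<inverse> = Id_on (Domain s)" by (auto dest: single_valuedD)
  then show "s O t\<inverse> = Id_on {1..k}" using * full_tangles_Domain[of s k m] by auto
qed

section \<open>The algebra of tangles\<close>

abbreviation ap_smult :: "complex \<Rightarrow> ap \<Rightarrow> ap" where
  "ap_smult c \<equiv> Poly_Mapping.map ((*) c)"

lemma lookup_ap_smult [simp]: "Poly_Mapping.lookup (ap_smult c f) t = c * Poly_Mapping.lookup f t"
  by (simp add: Poly_Mapping.map.rep_eq when_def)

lemma ap_smult_zero [simp]: "ap_smult c 0 = 0"
  by (rule poly_mapping_eqI) simp

lemma ap_smult_add: "ap_smult c (f + g) = ap_smult c f + ap_smult c g"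
  by (rule poly_mapping_eqI) (simp add: lookup_add distrib_left)

lemma keys_ap_smult: "Poly_Mapping.keys (ap_smult c f) \<subseteq> Poly_Mapping.keys f"
  by (auto simp: in_keys_iff)

text \<open>Reduces additive claims to single tangles with a coefficient; the set \<open>A\<close>
  keeps all pieces inside one morphism space or ideal.\<close>

lemma ap_induct [consumes 1, case_names zero single add]:
  fixes f :: ap
  assumes "Poly_Mapping.keys f \<subseteq> A" and zero: "P 0"
    and single: "\<And>t c. t \<in> A \<Longrightarrow> P (Poly_Mapping.single t c)"
    and add: "\<And>f g. \<lbrakk>Poly_Mapping.keys f \<subseteq> A; Poly_Mapping.keys g \<subseteq> A; P f; P g\<rbrakk> \<Longrightarrow> P (f + g)"
  shows "P f"
proof -
  let ?s = "\<lambda>S. \<Sum>t\<in>S. Poly_Mapping.single t (Poly_Mapping.lookup f t)"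
  have "Poly_Mapping.keys (?s S) \<subseteq> A \<and> P (?s S)" if "finite S" "S \<subseteq> A" for S
    using that
  proof (induction S)
    case empty
    then show ?case by (simp add: zero)
  next
    case (insert t S)
    let ?t = "Poly_Mapping.single t (Poly_Mapping.lookup f t)"
    have t: "Poly_Mapping.keys ?t \<subseteq> A" using insert.prems by simp
    then have "Poly_Mapping.keys (?t + ?s S) \<subseteq> A"
      using insert keys_add[of ?t "?s S"] by blast
    then show ?case
      using insert t by (auto intro!: add single)
  qed
  moreover have "f = ?s (Poly_Mapping.keys f)"
    by (rule poly_mapping_eqI)
      (auto simp: lookup_sum lookup_single when_def in_keys_iff)
  ultimately show ?thesis using assms(1) by (metis finite_keys)
qed

lemma ap_induct_all [case_names zero single add]:
  fixes f :: ap
  assumes "P 0" "\<And>t c. P (Poly_Mapping.single t c)" "\<And>f g. \<lbrakk>P f; P g\<rbrakk> \<Longrightarrow> P (f + g)"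
  shows "P f"
  by (rule ap_induct[of f UNIV]) (use assms in auto)

text \<open>Terms may cancel in a sum, so the supports of the summands and of the sum differ. Common
  finite index sets turn bilinearity into distributivity term by term.\<close>

lemma ap_comp_expand:
  assumes "finite S" "Poly_Mapping.keys f \<subseteq> S" "finite T" "Poly_Mapping.keys g \<subseteq> T"
  shows "g \<circ>\<^sub>A f = (\<Sum>s\<in>S. \<Sum>t\<in>T.
    Poly_Mapping.single (s O t) (Poly_Mapping.lookup g t * Poly_Mapping.lookup f s))"
proof -
  have "g \<circ>\<^sub>A f = (\<Sum>s\<in>Poly_Mapping.keys f. \<Sum>t\<in>T.
      Poly_Mapping.single (s O t) (Poly_Mapping.lookup g t * Poly_Mapping.lookup f s))"
    unfolding ap_comp_def using assms
    by (intro sum.cong refl sum.mono_neutral_left) (auto simp: in_keys_iff)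
  also have "\<dots> = (\<Sum>s\<in>S. \<Sum>t\<in>T.
      Poly_Mapping.single (s O t) (Poly_Mapping.lookup g t * Poly_Mapping.lookup f s))"
    using assms by (intro sum.mono_neutral_left) (auto simp: in_keys_iff)
  finally show ?thesis .
qed

lemma ap_comp_add_left: "(g + g') \<circ>\<^sub>A f = g \<circ>\<^sub>A f + g' \<circ>\<^sub>A f"
proof -
  let ?T = "Poly_Mapping.keys g \<union> Poly_Mapping.keys g'"
  note e = ap_comp_expand[where S = "Poly_Mapping.keys f" and T = ?T and f = f]
  have "Poly_Mapping.keys (g + g') \<subseteq> ?T" by (rule keys_add)
  then show ?thesis
    by (simp add: e lookup_add distrib_right single_add sum.distrib)
qed

lemma ap_comp_add_right: "g \<circ>\<^sub>A (f + f') = g \<circ>\<^sub>A f + g \<circ>\<^sub>A f'"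
proof -
  let ?S = "Poly_Mapping.keys f \<union> Poly_Mapping.keys f'"
  note e = ap_comp_expand[where S = ?S and T = "Poly_Mapping.keys g" and g = g]
  have "Poly_Mapping.keys (f + f') \<subseteq> ?S" by (rule keys_add)
  then show ?thesis
    by (simp add: e lookup_add distrib_left single_add sum.distrib)
qed

lemma ap_comp_zero [simp]: "0 \<circ>\<^sub>A f = 0" "g \<circ>\<^sub>A 0 = 0"
  by (simp_all add: ap_comp_def)

lemma ap_comp_single [simp]:
  "Poly_Mapping.single t d \<circ>\<^sub>A Poly_Mapping.single s c = Poly_Mapping.single (s O t) (d * c)"
  by (simp add: ap_comp_def)

lemma ap_comp_smult_left: "ap_smult c g \<circ>\<^sub>A f = ap_smult c (g \<circ>\<^sub>A f)"
proof (induction f rule: ap_induct_all)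
  case (single s d)
  show ?case
    by (induction g rule: ap_induct_all)
      (auto simp: map_single ap_smult_add ap_comp_add_left mult.assoc)
qed (auto simp: ap_smult_add ap_comp_add_right)

lemma ap_comp_smult_right: "g \<circ>\<^sub>A ap_smult c f = ap_smult c (g \<circ>\<^sub>A f)"
proof (induction f rule: ap_induct_all)
  case (single s d)
  show ?case
    by (induction g rule: ap_induct_all)
      (auto simp: map_single ap_smult_add ap_comp_add_left mult.left_commute)
qed (auto simp: ap_smult_add ap_comp_add_right)

lemma ap_comp_diff_right: "g \<circ>\<^sub>A (f - f') = g \<circ>\<^sub>A f - g \<circ>\<^sub>A f'"
  using ap_comp_add_right[of g "f - f'" f'] by (simp add: algebra_simps)

lemma ap_comp_diff_left: "(g - g') \<circ>\<^sub>A f = g \<circ>\<^sub>A f - g' \<circ>\<^sub>A f"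
  using ap_comp_add_left[of "g - g'" g' f] by (simp add: algebra_simps)

lemma ap_comp_sum_right: "g \<circ>\<^sub>A (\<Sum>i\<in>I. f i) = (\<Sum>i\<in>I. g \<circ>\<^sub>A f i)"
  by (induction I rule: infinite_finite_induct) (simp_all add: ap_comp_add_right)

lemma ap_comp_sum_left: "(\<Sum>i\<in>I. g i) \<circ>\<^sub>A f = (\<Sum>i\<in>I. g i \<circ>\<^sub>A f)"
  by (induction I rule: infinite_finite_induct) (simp_all add: ap_comp_add_left)

lemma ap_comp_assoc: "h \<circ>\<^sub>A g \<circ>\<^sub>A f = h \<circ>\<^sub>A (g \<circ>\<^sub>A f)"
proof (induction f rule: ap_induct_all)
  case (single s c)
  show ?case
  proof (induction g rule: ap_induct_all)
    case (single t d)
    show ?case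
      by (induction h rule: ap_induct_all)
        (auto simp: ap_comp_add_left O_assoc mult.assoc)
  qed (auto simp: ap_comp_add_left ap_comp_add_right)
qed (auto simp: ap_comp_add_right)

lemma lookup_ap_adj: "Poly_Mapping.lookup (ap_adj f) t = cnj (Poly_Mapping.lookup f (t\<inverse>))"
proof -
  have "(\<Sum>s\<in>Poly_Mapping.keys f. cnj (Poly_Mapping.lookup f s) when s\<inverse> = t)
      = (\<Sum>s\<in>Poly_Mapping.keys f. if s = t\<inverse> then cnj (Poly_Mapping.lookup f (t\<inverse>)) else 0)"
    by (intro sum.cong) (auto simp: when_def)
  then show ?thesis
    by (auto simp: ap_adj_def lookup_sum lookup_single in_keys_iff)
qed

lemma ap_adj_zero [simp]: "ap_adj 0 = 0"
  by (rule poly_mapping_eqI) (simp add: lookup_ap_adj)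

lemma ap_adj_single [simp]: "ap_adj (Poly_Mapping.single t c) = Poly_Mapping.single (t\<inverse>) (cnj c)"
  by (simp add: ap_adj_def)

lemma ap_adj_add: "ap_adj (f + g) = ap_adj f + ap_adj g"
  by (rule poly_mapping_eqI) (simp add: lookup_ap_adj lookup_add)

lemma ap_adj_diff: "ap_adj (f - g) = ap_adj f - ap_adj g"
  by (rule poly_mapping_eqI) (simp add: lookup_ap_adj lookup_minus)

lemma ap_adj_adj [simp]: "ap_adj (ap_adj f) = f"
  by (rule poly_mapping_eqI) (simp add: lookup_ap_adj)

lemma ap_adj_comp: "ap_adj (g \<circ>\<^sub>A f) = ap_adj f \<circ>\<^sub>A ap_adj g"
proof (induction f rule: ap_induct_all)
  case (single s c)
  show ?case
    by (induction g rule: ap_induct_all)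
      (auto simp: ap_comp_add_left ap_comp_add_right ap_adj_add converse_relcomp mult.commute)
qed (auto simp: ap_comp_add_left ap_comp_add_right ap_adj_add)

lemma keys_ap_comp:
  "Poly_Mapping.keys (g \<circ>\<^sub>A f) \<subseteq> {s O t | s t. s \<in> Poly_Mapping.keys f \<and> t \<in> Poly_Mapping.keys g}"
proof
  fix r assume r: "r \<in> Poly_Mapping.keys (g \<circ>\<^sub>A f)"
  show "r \<in> {s O t | s t. s \<in> Poly_Mapping.keys f \<and> t \<in> Poly_Mapping.keys g}"
  proof (rule ccontr)
    assume "\<not> ?thesis"
    then have "Poly_Mapping.lookup (g \<circ>\<^sub>A f) r = 0"
      by (auto simp: ap_comp_def lookup_sum lookup_single when_def intro!: sum.neutral)
    then show False using r by (simp add: in_keys_iff)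
  qed
qed

lemma AP_simps [simp]:
  "carrier (AP m n) = {f. Poly_Mapping.keys f \<subseteq> tangles m n}"
  "f \<oplus>\<^bsub>AP m n\<^esub> g = f + g" "\<zero>\<^bsub>AP m n\<^esub> = 0" "c \<odot>\<^bsub>AP m n\<^esub> f = ap_smult c f"
  "f \<otimes>\<^bsub>AP m n\<^esub> g = f \<circ>\<^sub>A g"
  by (simp_all add: AP_def)

lemma AP_zero: "0 \<in> carrier (AP m n)"
  by simp

lemma AP_single: "t \<in> tangles m n \<Longrightarrow> Poly_Mapping.single t c \<in> carrier (AP m n)"
  by simp

lemma AP_add: "f \<in> carrier (AP m n) \<Longrightarrow> g \<in> carrier (AP m n) \<Longrightarrow> f + g \<in> carrier (AP m n)"
  using keys_add[of f g] by auto

lemma AP_diff: "f \<in> carrier (AP m n) \<Longrightarrow> g \<in> carrier (AP m n) \<Longrightarrow> f - g \<in> carrier (AP m n)"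
  using keys_diff[of f g] by auto

lemma AP_smult: "f \<in> carrier (AP m n) \<Longrightarrow> ap_smult c f \<in> carrier (AP m n)"
  using keys_ap_smult[of c f] by auto

lemma AP_comp:
  "f \<in> carrier (AP l m) \<Longrightarrow> g \<in> carrier (AP m n) \<Longrightarrow> g \<circ>\<^sub>A f \<in> carrier (AP l n)"
  using keys_ap_comp[of g f] tangles_comp by fastforce

lemma AP_sum: "(\<And>i. i \<in> I \<Longrightarrow> f i \<in> carrier (AP m n)) \<Longrightarrow> (\<Sum>i\<in>I. f i) \<in> carrier (AP m n)"
proof (induction I rule: infinite_finite_induct)
  case (insert i I)
  then show ?case using AP_add[of "f i" m n "sum f I"] by simp
qed simp_all

lemma AP_adj:
  assumes "f \<in> carrier (AP m n)"
  shows "ap_adj f \<in> carrier (AP n m)"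
proof -
  have "t \<in> tangles n m" if "t \<in> Poly_Mapping.keys (ap_adj f)" for t
    using that assms tangles_converse[of "t\<inverse>" m n] by (auto simp: in_keys_iff lookup_ap_adj)
  then show ?thesis by auto
qed

lemma ap_comp_id_left:
  assumes "f \<in> carrier (AP m n)"
  shows "ap_id n \<circ>\<^sub>A f = f"
proof -
  have "Poly_Mapping.keys f \<subseteq> tangles m n" using assms by simp
  then show ?thesis
  proof (induction f rule: ap_induct)
    case (single t c)
    then have "t O Id_on {1..n} = t" by (auto simp: tangles_def)
    then show ?case by (simp add: ap_id_def)
  qed (auto simp: ap_comp_add_right)
qed

section \<open>Congruence modulo tangles with fewer than \<open>k\<close> through strings\<close>

text \<open>On \<open>AP k m\<close> this is congruence modulo \<open>AI k m\<close>, expressed by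
  the coefficients that survive in the quotient. Equations between cosets thereby become equations
  between numbers.\<close>

definition ap_cong :: "nat \<Rightarrow> nat \<Rightarrow> ap \<Rightarrow> ap \<Rightarrow> bool" where
  "ap_cong k m f g \<longleftrightarrow> (\<forall>t\<in>full_tangles k m. Poly_Mapping.lookup f t = Poly_Mapping.lookup g t)"

lemma AI_iff: "f \<in> AI k m \<longleftrightarrow> f \<in> carrier (AP k m) \<and> ap_cong k m f 0"
proof -
  have "card t \<le> k" if "t \<in> tangles k m" for t
    using that by (rule card_tangle_le(1))
  then show ?thesis
    by (fastforce simp: AI_def ap_cong_def full_tangles_def in_keys_iff)
qed

lemma AI_AP: "f \<in> AI k m \<Longrightarrow> f \<in> carrier (AP k m)"
  by (simp add: AI_iff)

lemma ap_cong_iff_AI: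
  assumes "f \<in> carrier (AP k m)" "g \<in> carrier (AP k m)"
  shows "ap_cong k m f g \<longleftrightarrow> f - g \<in> AI k m"
proof -
  have "ap_cong k m f g \<longleftrightarrow> ap_cong k m (f - g) 0" by (simp add: ap_cong_def lookup_minus)
  then show ?thesis unfolding AI_iff using AP_diff[OF assms] by blast
qed

lemma ap_cong_refl [simp]: "ap_cong k m f f"
  by (simp add: ap_cong_def)

lemma ap_cong_sym: "ap_cong k m f g \<Longrightarrow> ap_cong k m g f"
  by (simp add: ap_cong_def)

lemma ap_cong_trans: "ap_cong k m f g \<Longrightarrow> ap_cong k m g h \<Longrightarrow> ap_cong k m f h"
  by (simp add: ap_cong_def)

lemma ap_cong_add: "ap_cong k m f f' \<Longrightarrow> ap_cong k m g g' \<Longrightarrow> ap_cong k m (f + g) (f' + g')"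
  by (simp add: ap_cong_def lookup_add)

lemma ap_cong_smult: "ap_cong k m f f' \<Longrightarrow> ap_cong k m (ap_smult c f) (ap_smult c f')"
  by (simp add: ap_cong_def)

text \<open>A composite has no more through strings than its first factor. Hence the action by left
  composition is well defined on classes.\<close>

lemma AI_comp_left:
  assumes f: "f \<in> AI k m" and g: "g \<in> carrier (AP m n)"
  shows "g \<circ>\<^sub>A f \<in> AI k n"
proof -
  have "s O t \<in> tangles k n \<and> card (s O t) < k"
    if "s \<in> Poly_Mapping.keys f" "t \<in> Poly_Mapping.keys g" for s t
  proof -
    have "s \<in> tangles k m" "card s < k" "t \<in> tangles m n"
      using f g that by (auto simp: AI_def)
    then show ?thesis using card_comp_le_left[of s k m t n] tangles_comp[of s k m t n] by simp
  qed
  then show ?thesis using keys_ap_comp[of g f] by (auto simp: AI_def)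
qed

lemma AI_comp_right:
  assumes g: "g \<in> AI k m" and f: "f \<in> carrier (AP k k)"
  shows "g \<circ>\<^sub>A f \<in> AI k m"
proof -
  have "s O t \<in> tangles k m \<and> card (s O t) < k"
    if "s \<in> Poly_Mapping.keys f" "t \<in> Poly_Mapping.keys g" for s t
  proof -
    have "t \<in> tangles k m" "card t < k" "s \<in> tangles k k"
      using f g that by (auto simp: AI_def)
    then show ?thesis using card_comp_le_right[of s k k t m] tangles_comp[of s k k t m] by simp
  qed
  then show ?thesis using keys_ap_comp[of g f] by (auto simp: AI_def)
qed

lemma AI_adj:
  assumes "f \<in> AI k k"
  shows "ap_adj f \<in> AI k k"
proof -
  have "t \<in> tangles k k \<and> card t < k" if "t \<in> Poly_Mapping.keys (ap_adj f)" for t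
    using that assms tangles_converse[of "t\<inverse>" k k]
    by (auto simp: AI_def in_keys_iff lookup_ap_adj subset_iff)
  then show ?thesis by (auto simp: AI_def)
qed

lemma ap_cong_comp_left:
  assumes "f \<in> carrier (AP k m)" "f' \<in> carrier (AP k m)" "g \<in> carrier (AP m n)" "ap_cong k m f f'"
  shows "ap_cong k n (g \<circ>\<^sub>A f) (g \<circ>\<^sub>A f')"
  using AI_comp_left[of "f - f'" k m g n] ap_cong_iff_AI[OF assms(1,2)] assms
    ap_cong_iff_AI[OF AP_comp[OF assms(1,3)] AP_comp[OF assms(2,3)]]
  by (simp only: ap_comp_diff_right)

lemma ap_cong_comp_right:
  assumes "f \<in> carrier (AP k m)" "f' \<in> carrier (AP k m)" "g \<in> carrier (AP k k)" "ap_cong k m f f'"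
  shows "ap_cong k m (f \<circ>\<^sub>A g) (f' \<circ>\<^sub>A g)"
  using AI_comp_right[of "f - f'" k m g] ap_cong_iff_AI[OF assms(1,2)] assms
    ap_cong_iff_AI[OF AP_comp[OF assms(3,1)] AP_comp[OF assms(3,2)]]
  by (simp only: ap_comp_diff_left)

lemma ap_cong_adj:
  assumes "f \<in> carrier (AP k k)" "f' \<in> carrier (AP k k)" "ap_cong k k f f'"
  shows "ap_cong k k (ap_adj f) (ap_adj f')"
  using AI_adj[of "f - f'" k] ap_cong_iff_AI[OF assms(1,2)] assms
    ap_cong_iff_AI[OF AP_adj[OF assms(1)] AP_adj[OF assms(2)]]
  by (simp only: ap_adj_diff)

text \<open>The dependence on b is reduced to the one on a, since \<open>b\<^sup>* a\<close> is the adjoint of \<open>a\<^sup>* b\<close>.\<close>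

lemma ap_cong_adj_comp:
  assumes a: "a \<in> carrier (AP k m)" "a' \<in> carrier (AP k m)" "ap_cong k m a a'"
    and b: "b \<in> carrier (AP k m)" "b' \<in> carrier (AP k m)" "ap_cong k m b b'"
  shows "ap_cong k k (ap_adj b \<circ>\<^sub>A a) (ap_adj b' \<circ>\<^sub>A a')"
proof (rule ap_cong_trans)
  show "ap_cong k k (ap_adj b \<circ>\<^sub>A a) (ap_adj b \<circ>\<^sub>A a')"
    by (rule ap_cong_comp_left[OF a(1,2) AP_adj[OF b(1)] a(3)])
  note c = AP_adj[OF a(2)]
  have "ap_cong k k (ap_adj a' \<circ>\<^sub>A b) (ap_adj a' \<circ>\<^sub>A b')"
    by (rule ap_cong_comp_left[OF b(1,2) c b(3)])
  then have "ap_cong k k (ap_adj (ap_adj a' \<circ>\<^sub>A b)) (ap_adj (ap_adj a' \<circ>\<^sub>A b'))"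
    by (rule ap_cong_adj[OF AP_comp[OF b(1) c] AP_comp[OF b(2) c]])
  then show "ap_cong k k (ap_adj b \<circ>\<^sub>A a') (ap_adj b' \<circ>\<^sub>A a')"
    by (simp add: ap_adj_comp)
qed

section \<open>Classes in the quotient and the operations on them\<close>

definition ap_class :: "nat \<Rightarrow> nat \<Rightarrow> ap \<Rightarrow> ap set" where
  "ap_class k m f = AI k m +>\<^bsub>AP k m\<^esub> f"

lemma ap_class_eq:
  assumes "f \<in> carrier (AP k m)"
  shows "ap_class k m f = {g \<in> carrier (AP k m). ap_cong k m g f}"
proof (intro equalityI subsetI)
  fix g assume "g \<in> ap_class k m f"
  then obtain h where h: "h \<in> AI k m" "g = h + f"
    by (auto simp: ap_class_def a_r_coset_def')
  then have "g \<in> carrier (AP k m)" using AP_add[OF AI_AP assms] by blast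
  moreover have "g - f \<in> AI k m" using h by simp
  ultimately show "g \<in> {g \<in> carrier (AP k m). ap_cong k m g f}"
    using ap_cong_iff_AI[OF _ assms] by blast
next
  fix g assume "g \<in> {g \<in> carrier (AP k m). ap_cong k m g f}"
  then have "g - f \<in> AI k m" using ap_cong_iff_AI[OF _ assms] by blast
  then show "g \<in> ap_class k m f"
    unfolding ap_class_def a_r_coset_def' by (intro UN_I[of "g - f"]) simp_all
qed

lemma ap_class_eq_iff:
  assumes "f \<in> carrier (AP k m)" "g \<in> carrier (AP k m)"
  shows "ap_class k m f = ap_class k m g \<longleftrightarrow> ap_cong k m f g"
proof
  assume "ap_class k m f = ap_class k m g"
  moreover have "f \<in> ap_class k m f" using assms(1) by (simp only: ap_class_eq) simp
  ultimately show "ap_cong k m f g" using assms(2) by (simp only: ap_class_eq) simp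
next
  assume fg: "ap_cong k m f g"
  show "ap_class k m f = ap_class k m g"
    unfolding ap_class_eq[OF assms(1)] ap_class_eq[OF assms(2)]
    using ap_cong_trans[OF _ fg] ap_cong_trans[OF _ ap_cong_sym[OF fg]] by blast
qed

lemma ap_class_self: "f \<in> carrier (AP k m) \<Longrightarrow> f \<in> ap_class k m f"
  by (simp only: ap_class_eq) simp

text \<open>\<open>quot_map\<close> unites the cosets of the images of all representatives;
  \<open>cong\<close> makes these cosets coincide, so the union is a single coset.\<close>

lemma quot_map_ap_class:
  assumes f: "f \<in> carrier (AP k m)"
    and F: "\<And>g. g \<in> carrier (AP k m) \<Longrightarrow> F g \<in> carrier (AP k n)"
    and cong: "\<And>g. \<lbrakk>g \<in> carrier (AP k m); ap_cong k m g f\<rbrakk> \<Longrightarrow> ap_cong k n (F g) (F f)"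
  shows "quot_map (AP k n) (AI k n) F (ap_class k m f) = ap_class k n (F f)"
proof -
  have "ap_class k n (F g) = ap_class k n (F f)" if "g \<in> ap_class k m f" for g
  proof -
    have g: "g \<in> carrier (AP k m)" "ap_cong k m g f"
      using that unfolding ap_class_eq[OF f] by blast+
    show ?thesis unfolding ap_class_eq_iff[OF F[OF g(1)] F[OF f]] using cong[OF g] .
  qed
  then show ?thesis
    unfolding quot_map_def ap_class_def[symmetric] using ap_class_self[OF f] by blast
qed

lemma APQ_carrier: "carrier (APQ k m) = ap_class k m ` carrier (AP k m)"
  by (auto simp: quot_module_def FactRing_def A_RCOSETS_def' ap_class_def)

lemma APQ_zero: "\<zero>\<^bsub>APQ k m\<^esub> = ap_class k m 0"
proof -
  have "ap_class k m 0 = AI k m"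
    unfolding ap_class_eq[OF AP_zero] by (auto simp only: AI_iff)
  then show ?thesis by (simp add: quot_module_def FactRing_def)
qed

lemma APQ_add:
  assumes "f \<in> carrier (AP k m)" "g \<in> carrier (AP k m)"
  shows "ap_class k m f \<oplus>\<^bsub>APQ k m\<^esub> ap_class k m g = ap_class k m (f + g)"
proof -
  have "ap_class k m f \<oplus>\<^bsub>APQ k m\<^esub> ap_class k m g
      = (\<Union>a\<in>ap_class k m f. \<Union>b\<in>ap_class k m g. {a + b})"
    by (simp add: quot_module_def FactRing_def set_add_def')
  also have "\<dots> = ap_class k m (f + g)"
  proof (intro equalityI subsetI)
    fix h assume "h \<in> (\<Union>a\<in>ap_class k m f. \<Union>b\<in>ap_class k m g. {a + b})"
    then obtain a b where "a \<in> ap_class k m f" "b \<in> ap_class k m g" "h = a + b" by blast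
    then show "h \<in> ap_class k m (f + g)"
      unfolding ap_class_eq[OF assms(1)] ap_class_eq[OF assms(2)] ap_class_eq[OF AP_add[OF assms]]
      using AP_add ap_cong_add by blast
  next
    fix h assume "h \<in> ap_class k m (f + g)"
    then have h: "h \<in> carrier (AP k m)" "ap_cong k m h (f + g)"
      unfolding ap_class_eq[OF AP_add[OF assms]] by blast+
    \<comment> \<open>With \<open>g\<close> kept as the second representative, the difference
      \<open>h - g\<close> serves as the first.\<close>
    then have "h - g \<in> ap_class k m f"
      unfolding ap_class_eq[OF assms(1)] using AP_diff[OF h(1) assms(2)]
      by (simp add: ap_cong_def lookup_minus lookup_add)
    then show "h \<in> (\<Union>a\<in>ap_class k m f. \<Union>b\<in>ap_class k m g. {a + b})"
      using ap_class_self[OF assms(2)] by (intro UN_I[of "h - g"] UN_I[of g]) simp_all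
  qed
  finally show ?thesis .
qed

lemma APQ_smult:
  assumes "f \<in> carrier (AP k m)"
  shows "c \<odot>\<^bsub>APQ k m\<^esub> ap_class k m f = ap_class k m (ap_smult c f)"
proof -
  have "c \<odot>\<^bsub>APQ k m\<^esub> ap_class k m f
      = quot_map (AP k m) (AI k m) (ap_smult c) (ap_class k m f)"
    by (simp add: quot_module_def)
  also have "\<dots> = ap_class k m (ap_smult c f)"
    using AP_smult ap_cong_smult by (intro quot_map_ap_class[OF assms]) blast+
  finally show ?thesis .
qed

lemma APQ_mult:
  assumes f: "f \<in> carrier (AP k k)" and g: "g \<in> carrier (AP k k)"
  shows "ap_class k k f \<otimes>\<^bsub>APQ k k\<^esub> ap_class k k g = ap_class k k (f \<circ>\<^sub>A g)"
proof -
  have "ap_class k k f \<otimes>\<^bsub>APQ k k\<^esub> ap_class k k g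
      = (\<Union>a\<in>ap_class k k f. \<Union>b\<in>ap_class k k g. ap_class k k (a \<circ>\<^sub>A b))"
    by (simp add: quot_module_def FactRing_def rcoset_mult_def ap_class_def)
  also have "\<dots> = ap_class k k (f \<circ>\<^sub>A g)"
  proof -
    have "ap_class k k (a \<circ>\<^sub>A b) = ap_class k k (f \<circ>\<^sub>A g)"
      if "a \<in> ap_class k k f" "b \<in> ap_class k k g" for a b
    proof -
      have a: "a \<in> carrier (AP k k)" "ap_cong k k a f"
        and b: "b \<in> carrier (AP k k)" "ap_cong k k b g"
        using that unfolding ap_class_eq[OF f] ap_class_eq[OF g] by blast+
      show ?thesis
        unfolding ap_class_eq_iff[OF AP_comp[OF b(1) a(1)] AP_comp[OF g f]]
        using ap_cong_comp_right[OF a(1) f b(1) a(2)] ap_cong_comp_left[OF b(1) g f b(2)]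
        by (rule ap_cong_trans)
    qed
    then show ?thesis using ap_class_self[OF f] ap_class_self[OF g] by blast
  qed
  finally show ?thesis .
qed

lemma APQ_star:
  assumes f: "f \<in> carrier (AP k k)"
  shows "quot_map (AP k k) (AI k k) ap_adj (ap_class k k f) = ap_class k k (ap_adj f)"
  using AP_adj ap_cong_adj[OF _ f] by (intro quot_map_ap_class[OF f]) blast+

section \<open>Eigenvectors of the internal rotation\<close>

declare AP_simps(1) [simp del]

section \<open>Coefficients of rotated morphisms and of adjoint products\<close>

lemma rotation_full: "rotation k \<in> full_tangles k k"
  using rot_full[of k 1] by (simp only: rot_1)

lemma Id_on_full: "Id_on {1..k} \<in> full_tangles k k"
  using rot_full[of k 0] by (simp only: rot_0)

lemma ap_tau_AP: "ap_tau k \<in> carrier (AP k k)"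
  unfolding ap_tau_def by (rule AP_single[OF full_tangles_tangle[OF rotation_full]])

text \<open>Precomposition with a rotation is injective on tangles, so a coefficient only moves to
  the rotated tangle and no other one is added to it.\<close>

lemma lookup_comp_rot:
  assumes f: "f \<in> carrier (AP k m)" and t: "t \<in> tangles k m"
  shows "Poly_Mapping.lookup (f \<circ>\<^sub>A tangle_elem (rot k j)) (rot k j O t) = Poly_Mapping.lookup f t"
proof -
  have "Poly_Mapping.keys f \<subseteq> tangles k m" using f by (simp add: AP_simps(1))
  then show ?thesis
  proof (induction f rule: ap_induct)
    case (single s c)
    have "rot k j O s = rot k j O t \<longleftrightarrow> s = t"
      using rot_cancel[OF single, of j] rot_cancel[OF t, of j] by metis
    then show ?case by (simp add: lookup_single when_def)
  qed (simp_all add: ap_comp_add_left lookup_add)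
qed

text \<open>By \<open>comp_converse_eq_Id\<close> a pair of tangles contributes to the identity only
  if the two are equal and full. So the identity coefficient computes the standard inner product on
  the coefficients of full tangles.\<close>

lemma lookup_adj_comp_Id:
  assumes a: "a \<in> carrier (AP k m)" and b: "b \<in> carrier (AP k m)"
  shows "Poly_Mapping.lookup (ap_adj b \<circ>\<^sub>A a) (Id_on {1..k})
    = (\<Sum>t\<in>full_tangles k m. Poly_Mapping.lookup a t * cnj (Poly_Mapping.lookup b t))"
proof -
  have "Poly_Mapping.keys a \<subseteq> tangles k m" using a by (simp add: AP_simps(1))
  then show ?thesis
  proof (induction a rule: ap_induct)
    case s: (single s c)
    have "Poly_Mapping.keys b \<subseteq> tangles k m" using b by (simp add: AP_simps(1))
    then show ?case
    proof (induction b rule: ap_induct)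
      case t: (single t d)
      let ?p = "\<lambda>u. (c when s = u) * cnj (d when t = u)"
      have "sum ?p (full_tangles k m) = (\<Sum>u\<in>full_tangles k m. if u = s then ?p s else 0)"
        by (intro sum.cong) (auto simp: when_def)
      also have "\<dots> = (if s \<in> full_tangles k m then ?p s else 0)"
        using finite_full_tangles by simp
      also have "\<dots> = (cnj d * c when s O t\<inverse> = Id_on {1..k})"
        unfolding comp_converse_eq_Id[OF s t] by (auto simp: when_def)
      finally show ?case by (simp add: lookup_single)
    qed (simp_all add: ap_comp_add_left ap_adj_add lookup_add distrib_left sum.distrib)
  qed (simp_all add: ap_comp_add_right lookup_add distrib_right sum.distrib)
qed

lemma cring_complex_ring: "cring complex_ring"
  by (intro cringI abelian_groupI comm_monoidI)
    (auto simp: complex_ring_def algebra_simps intro: exI[of _ "- x" for x])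

lemma complex_ring_simps [simp]:
  "carrier complex_ring = UNIV" "x \<oplus>\<^bsub>complex_ring\<^esub> y = x + y" "x \<otimes>\<^bsub>complex_ring\<^esub> y = x * y"
  "\<one>\<^bsub>complex_ring\<^esub> = 1" "\<zero>\<^bsub>complex_ring\<^esub> = 0"
  by (simp_all add: complex_ring_def)

section \<open>Spans of finite sets of vectors\<close>

definition lin_span :: "(complex, 'v, 'm) module_scheme \<Rightarrow> 'v set \<Rightarrow> 'v set" where
  "lin_span H B = {x. \<exists>c. x = (\<Oplus>\<^bsub>H\<^esub>b\<in>B. c b \<odot>\<^bsub>H\<^esub> b)}"

context
  fixes H :: "(complex, 'v, 'm) module_scheme" and B
  assumes H: "Module.module complex_ring H" and B: "finite B" "B \<subseteq> carrier H"
begin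

interpretation Module.module complex_ring H by (rule H)

lemma lin_span_add:
  assumes "x \<in> lin_span H B" "y \<in> lin_span H B"
  shows "x \<oplus>\<^bsub>H\<^esub> y \<in> lin_span H B"
proof -
  obtain c d where "x = (\<Oplus>\<^bsub>H\<^esub>b\<in>B. c b \<odot>\<^bsub>H\<^esub> b)" "y = (\<Oplus>\<^bsub>H\<^esub>b\<in>B. d b \<odot>\<^bsub>H\<^esub> b)"
    using assms by (auto simp: lin_span_def)
  moreover have "(\<Oplus>\<^bsub>H\<^esub>b\<in>B. (c b + d b) \<odot>\<^bsub>H\<^esub> b) = (\<Oplus>\<^bsub>H\<^esub>b\<in>B. c b \<odot>\<^bsub>H\<^esub> b \<oplus>\<^bsub>H\<^esub> d b \<odot>\<^bsub>H\<^esub> b)"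
    using B smult_l_distr by (intro M.finsum_cong') auto
  moreover have "\<dots> = (\<Oplus>\<^bsub>H\<^esub>b\<in>B. c b \<odot>\<^bsub>H\<^esub> b) \<oplus>\<^bsub>H\<^esub> (\<Oplus>\<^bsub>H\<^esub>b\<in>B. d b \<odot>\<^bsub>H\<^esub> b)"
    using B by (intro M.finsum_addf) auto
  ultimately show ?thesis unfolding lin_span_def by (intro CollectI exI[of _ "\<lambda>b. c b + d b"]) simp
qed

lemma lin_span_smult:
  assumes "x \<in> lin_span H B"
  shows "a \<odot>\<^bsub>H\<^esub> x \<in> lin_span H B"
proof -
  obtain c where "x = (\<Oplus>\<^bsub>H\<^esub>b\<in>B. c b \<odot>\<^bsub>H\<^esub> b)"
    using assms by (auto simp: lin_span_def)
  moreover have "a \<odot>\<^bsub>H\<^esub> (\<Oplus>\<^bsub>H\<^esub>b\<in>B. c b \<odot>\<^bsub>H\<^esub> b) = (\<Oplus>\<^bsub>H\<^esub>b\<in>B. a \<odot>\<^bsub>H\<^esub> (c b \<odot>\<^bsub>H\<^esub> b))"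
    using B by (intro finsum_smult_ldistr) auto
  moreover have "(\<Oplus>\<^bsub>H\<^esub>b\<in>B. a \<odot>\<^bsub>H\<^esub> (c b \<odot>\<^bsub>H\<^esub> b)) = (\<Oplus>\<^bsub>H\<^esub>b\<in>B. (a * c b) \<odot>\<^bsub>H\<^esub> b)"
    using B smult_assoc1 by (intro M.finsum_cong') auto
  ultimately show ?thesis unfolding lin_span_def by (intro CollectI exI[of _ "\<lambda>b. a * c b"]) simp
qed

lemma lin_span_zero: "\<zero>\<^bsub>H\<^esub> \<in> lin_span H B"
proof -
  have "(\<Oplus>\<^bsub>H\<^esub>b\<in>B. 0 \<odot>\<^bsub>H\<^esub> b) = (\<Oplus>\<^bsub>H\<^esub>b\<in>B. \<zero>\<^bsub>H\<^esub>)"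
    using B smult_l_null by (intro M.finsum_cong') auto
  then show ?thesis
    unfolding lin_span_def by (intro CollectI exI[of _ "\<lambda>_. 0"]) (simp add: M.finsum_zero)
qed

lemma lin_span_superset:
  assumes b: "b \<in> B"
  shows "b \<in> lin_span H B"
proof -
  have "(\<Oplus>\<^bsub>H\<^esub>x\<in>B. (if x = b then 1 else 0) \<odot>\<^bsub>H\<^esub> x) = (\<Oplus>\<^bsub>H\<^esub>x\<in>B. if b = x then x else \<zero>\<^bsub>H\<^esub>)"
    using B b smult_one smult_l_null by (intro M.finsum_cong') auto
  also have "\<dots> = b"
    using B by (intro M.finsum_singleton[OF b]) auto
  finally show ?thesis
    unfolding lin_span_def by (intro CollectI exI[of _ "\<lambda>x. if x = b then 1 else 0"]) simp
qed

end

section \<open>Eigenvectors modulo lower tangles\<close>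

text \<open>\<open>max 1 k\<close> is the number of rotations; for \<open>k = 0\<close> the equation
  forces \<omega> = 1, in accordance with \<tau> = id.\<close>

locale rotation_eigenvalue =
  fixes k :: nat and \<omega> :: complex
  assumes root: "\<omega> ^ max 1 k = 1"
begin

lemma omega_nonzero: "\<omega> \<noteq> 0"
proof
  assume "\<omega> = 0"
  then show False using root by (simp add: zero_power)
qed

text \<open>The representatives of vectors in the \<omega>-eigenspace, so that later arguments deal
  with morphisms instead of cosets.\<close>

definition eig :: "nat \<Rightarrow> ap set" where
  "eig m = {f \<in> carrier (AP k m). ap_cong k m (f \<circ>\<^sub>A ap_tau k) (ap_smult \<omega> f)}"

lemma eig_AP: "f \<in> eig m \<Longrightarrow> f \<in> carrier (AP k m)"
  by (simp add: eig_def)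

lemma eig_zero: "0 \<in> eig m"
  by (simp add: eig_def AP_zero)

lemma eig_add: "f \<in> eig m \<Longrightarrow> g \<in> eig m \<Longrightarrow> f + g \<in> eig m"
  by (simp add: eig_def AP_add ap_comp_add_left ap_smult_add ap_cong_add)

lemma eig_smult: "f \<in> eig m \<Longrightarrow> ap_smult c f \<in> eig m"
  by (auto simp: eig_def ap_comp_smult_left AP_smult ap_cong_def)

lemma eig_comp:
  assumes f: "f \<in> eig m" and g: "g \<in> carrier (AP m n)"
  shows "g \<circ>\<^sub>A f \<in> eig n"
proof -
  have f': "f \<in> carrier (AP k m)" "ap_cong k m (f \<circ>\<^sub>A ap_tau k) (ap_smult \<omega> f)"
    using f by (simp_all add: eig_def)
  show ?thesis
    using ap_cong_comp_left[OF AP_comp[OF ap_tau_AP f'(1)] AP_smult[OF f'(1)] g f'(2)]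
      AP_comp[OF f'(1) g]
    by (simp add: eig_def ap_comp_assoc ap_comp_smult_right)
qed

lemma eig_comp_rot:
  assumes f: "f \<in> eig m"
  shows "ap_cong k m (f \<circ>\<^sub>A tangle_elem (rot k j)) (ap_smult (\<omega> ^ j) f)"
proof (induction j)
  case 0
  have "Poly_Mapping.lookup (f \<circ>\<^sub>A tangle_elem (rot k 0)) t = Poly_Mapping.lookup f t"
    if "t \<in> full_tangles k m" for t
  proof -
    have "rot k 0 O t = t"
      using full_tangles_tangle[OF that] by (auto simp: rot_0 tangles_def)
    then show ?thesis
      using lookup_comp_rot[OF eig_AP[OF f] full_tangles_tangle[OF that], of 0] by simp
  qed
  then show ?case unfolding ap_cong_def lookup_ap_smult power_0 by simp
next
  case (Suc j)
  have f': "f \<in> carrier (AP k m)" "ap_cong k m (f \<circ>\<^sub>A ap_tau k) (ap_smult \<omega> f)"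
    using f by (simp_all add: eig_def)
  have r: "tangle_elem (rot k j) \<in> carrier (AP k k)" by (rule AP_single[OF rot_tangles])
  have "tangle_elem (rot k (Suc j)) = ap_tau k \<circ>\<^sub>A tangle_elem (rot k j)"
    by (simp add: ap_tau_def rot_1[symmetric] rot_comp)
  then have "f \<circ>\<^sub>A tangle_elem (rot k (Suc j)) = f \<circ>\<^sub>A ap_tau k \<circ>\<^sub>A tangle_elem (rot k j)"
    by (simp add: ap_comp_assoc)
  moreover have "ap_cong k m (f \<circ>\<^sub>A ap_tau k \<circ>\<^sub>A tangle_elem (rot k j))
      (ap_smult \<omega> (f \<circ>\<^sub>A tangle_elem (rot k j)))"
    using ap_cong_comp_right[OF AP_comp[OF ap_tau_AP f'(1)] AP_smult[OF f'(1)] r f'(2)]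
    by (simp add: ap_comp_smult_left)
  moreover have "ap_cong k m (ap_smult \<omega> (f \<circ>\<^sub>A tangle_elem (rot k j))) (ap_smult (\<omega> ^ Suc j) f)"
    using Suc by (simp add: ap_cong_def)
  ultimately show ?case by (metis ap_cong_trans)
qed

text \<open>Rotation moves coefficients by \<open>lookup_comp_rot\<close>, while on an eigenvector
  it only scales them. One coefficient therefore determines all others along its rotation
  orbit.\<close>

lemma eig_lookup_rot:
  assumes f: "f \<in> eig m" and t: "t \<in> full_tangles k m"
  shows "Poly_Mapping.lookup f t = \<omega> ^ j * Poly_Mapping.lookup f (rot k j O t)"
proof -
  have "Poly_Mapping.lookup f t = Poly_Mapping.lookup (f \<circ>\<^sub>A tangle_elem (rot k j)) (rot k j O t)"
    using lookup_comp_rot[OF eig_AP[OF f] full_tangles_tangle[OF t]] by simp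
  also have "\<dots> = \<omega> ^ j * Poly_Mapping.lookup f (rot k j O t)"
    using eig_comp_rot[OF f, of j] rot_comp_full[OF t, of j] by (simp add: ap_cong_def)
  finally show ?thesis .
qed

text \<open>Up to the factor \<open>max 1 k\<close>, the projection in the group algebra of the
  rotations that belongs to the eigenvalue \<omega>. It is left unnormalized so that its identity
  coefficient is 1.\<close>

definition rot_sum :: ap where
  "rot_sum = (\<Sum>j<max 1 k. Poly_Mapping.single (rot k j) (inverse \<omega> ^ j))"

lemma rot_sum_AP: "rot_sum \<in> carrier (AP k k)"
  unfolding rot_sum_def by (intro AP_sum AP_single rot_tangles)

lemma lookup_rot_sum_Id: "Poly_Mapping.lookup rot_sum (Id_on {1..k}) = 1"
proof -
  have "(inverse \<omega> ^ j when rot k j = rot k 0) = (if j = 0 then 1 else 0)" if "j < max 1 k" for j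
  proof -
    have "rot k j = rot k 0 \<longleftrightarrow> j = 0"
      using inj_on_eq_iff[OF inj_on_rot, of j k 0] that by simp
    then show ?thesis by (simp add: when_def)
  qed
  then have "Poly_Mapping.lookup rot_sum (rot k 0) = (\<Sum>j<max 1 k. if j = 0 then 1 else 0)"
    unfolding rot_sum_def lookup_sum lookup_single by (intro sum.cong) auto
  then show ?thesis by (simp add: rot_0)
qed

lemma rot_sum_shift:
  "(\<Sum>j<max 1 k. Poly_Mapping.single (rot k (Suc j)) (inverse \<omega> ^ j)) = ap_smult \<omega> rot_sum"
proof -
  \<comment> \<open>The factor \<omega> makes \<open>h (Suc j)\<close> the summand on the left,
    while the \<open>h j\<close> add up to the right-hand side. Since
    \<open>h (max 1 k) = h 0\<close>, shifting the index does not change the sum.\<close>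
  define h where "h j = Poly_Mapping.single (rot k j) (\<omega> * inverse \<omega> ^ j)" for j
  have "inverse \<omega> ^ max 1 k = 1" using root by (simp add: power_inverse)
  moreover have "rot k (max 1 k) = rot k 0"
    using rot_self[of k] by (cases "k = 0") (auto simp: rot_0 rot_def max_def)
  ultimately have "h (max 1 k) = h 0" by (simp add: h_def)
  then have "(\<Sum>j<max 1 k. h (Suc j)) = (\<Sum>j<max 1 k. h j)"
    using sum.lessThan_Suc_shift[of h "max 1 k"] by (simp add: add.commute)
  moreover have "h (Suc j) = Poly_Mapping.single (rot k (Suc j)) (inverse \<omega> ^ j)" for j
    using omega_nonzero by (simp add: h_def mult.assoc[symmetric])
  moreover have "(\<Sum>j<max 1 k. h j) = ap_smult \<omega> rot_sum"
    by (rule poly_mapping_eqI)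
      (simp add: rot_sum_def h_def lookup_sum lookup_single sum_distrib_left mult_when)
  ultimately show ?thesis by simp
qed

lemma rot_sum_tau: "rot_sum \<circ>\<^sub>A ap_tau k = ap_smult \<omega> rot_sum"
proof -
  have "rot_sum \<circ>\<^sub>A ap_tau k = (\<Sum>j<max 1 k. Poly_Mapping.single (rot k (Suc j)) (inverse \<omega> ^ j))"
    unfolding rot_sum_def ap_comp_sum_left ap_tau_def
    by (simp add: rot_1[symmetric] rot_comp)
  then show ?thesis using rot_sum_shift by simp
qed

lemma rot_sum_eig: "rot_sum \<in> eig k"
  by (simp add: eig_def rot_sum_AP rot_sum_tau)

text \<open>The rotation by \<open>j\<close> scales an eigenvector by \<omega>^j, which cancels the
  weight in \<open>rot_sum\<close>; each of the \<open>max 1 k\<close> summands returns the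
  vector.\<close>

lemma eig_comp_rot_sum:
  assumes f: "f \<in> eig m"
  shows "ap_cong k m (f \<circ>\<^sub>A rot_sum) (ap_smult (of_nat (max 1 k)) f)"
  unfolding ap_cong_def
proof
  fix t assume t: "t \<in> full_tangles k m"
  have single: "Poly_Mapping.single (rot k j) (inverse \<omega> ^ j)
      = ap_smult (inverse \<omega> ^ j) (tangle_elem (rot k j))" for j
    by (simp add: map_single)
  have "Poly_Mapping.lookup (f \<circ>\<^sub>A Poly_Mapping.single (rot k j) (inverse \<omega> ^ j)) t
      = inverse \<omega> ^ j * (\<omega> ^ j * Poly_Mapping.lookup f t)" for j
    using eig_comp_rot[OF f, of j] t
    unfolding single ap_comp_smult_right by (simp add: ap_cong_def)
  moreover have "inverse \<omega> ^ j * (\<omega> ^ j * x) = x" for j x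
    using omega_nonzero by (simp add: power_inverse)
  ultimately show "Poly_Mapping.lookup (f \<circ>\<^sub>A rot_sum) t
      = Poly_Mapping.lookup (ap_smult (of_nat (max 1 k)) f) t"
    unfolding rot_sum_def ap_comp_sum_right lookup_sum by simp
qed

text \<open>The eigenspace inside the group algebra of the rotations is one-dimensional.\<close>

lemma eig_endo:
  assumes h: "h \<in> eig k"
  shows "ap_cong k k h (ap_smult (Poly_Mapping.lookup h (Id_on {1..k})) rot_sum)"
  unfolding ap_cong_def
proof
  fix t assume "t \<in> full_tangles k k"
  then obtain j where t: "t = rot k j" by (auto simp: full_tangles_eq_rot)
  have "rot k j O rot k 0 = rot k j" by (simp add: rot_comp)
  then have j: "rot k j O Id_on {1..k} = rot k j" by (simp only: rot_0)
  \<comment> \<open>From \<open>t\<close> to the identity the coefficients of \<open>h\<close> and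
    of \<open>rot_sum\<close> change by the same factor, and that of \<open>rot_sum\<close> becomes
    1.\<close>
  have "Poly_Mapping.lookup h (Id_on {1..k}) = \<omega> ^ j * Poly_Mapping.lookup h t"
    using eig_lookup_rot[OF h Id_on_full, of j] by (simp only: j t)
  moreover have "1 = \<omega> ^ j * Poly_Mapping.lookup rot_sum t"
    using eig_lookup_rot[OF rot_sum_eig Id_on_full, of j] by (simp only: j t lookup_rot_sum_Id)
  ultimately show "Poly_Mapping.lookup h t
      = Poly_Mapping.lookup (ap_smult (Poly_Mapping.lookup h (Id_on {1..k})) rot_sum) t"
    using omega_nonzero by (simp add: mult.assoc)
qed

end

section \<open>The trace on eigenvectors\<close>

locale traced_rotation_eigenvalue = rotation_eigenvalue +
  fixes tr :: "ap set \<Rightarrow> complex"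
  assumes faithful: "faithful_trace k tr"
begin

lemma tr_smult:
  assumes "f \<in> carrier (AP k k)"
  shows "tr (ap_class k k (ap_smult c f)) = c * tr (ap_class k k f)"
  using faithful assms unfolding faithful_trace_def Let_def APQ_carrier
  by (metis APQ_smult imageI)

lemma tr_adj_self:
  assumes f: "f \<in> carrier (AP k k)"
  shows "tr (ap_class k k (ap_adj f \<circ>\<^sub>A f)) \<in> \<real>\<^sub>\<ge>\<^sub>0"
    and "tr (ap_class k k (ap_adj f \<circ>\<^sub>A f)) = 0 \<Longrightarrow> ap_cong k k f 0"
proof -
  have *: "quot_map (AP k k) (AI k k) ap_adj (ap_class k k f) \<otimes>\<^bsub>APQ k k\<^esub> ap_class k k f
      = ap_class k k (ap_adj f \<circ>\<^sub>A f)"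
    by (simp only: APQ_star[OF f] APQ_mult[OF AP_adj[OF f] f])
  have f': "ap_class k k f \<in> carrier (APQ k k)" unfolding APQ_carrier using f by blast
  show "tr (ap_class k k (ap_adj f \<circ>\<^sub>A f)) \<in> \<real>\<^sub>\<ge>\<^sub>0"
    using faithful f' unfolding faithful_trace_def Let_def *[symmetric] by blast
  assume "tr (ap_class k k (ap_adj f \<circ>\<^sub>A f)) = 0"
  then have "ap_class k k f = \<zero>\<^bsub>APQ k k\<^esub>"
    using faithful f' unfolding faithful_trace_def Let_def *[symmetric] by blast
  then show "ap_cong k k f 0" by (simp only: APQ_zero ap_class_eq_iff[OF f AP_zero])
qed

text \<open>The scale factor between the trace form and the standard inner product on
  coefficients.\<close>

definition rot_trace :: complex where
  "rot_trace = tr (ap_class k k rot_sum)"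

text \<open>A linear functional on a one-dimensional space is determined by its value on the
  generator \<open>rot_sum\<close>.\<close>

lemma tr_eig:
  assumes h: "h \<in> eig k"
  shows "tr (ap_class k k h) = rot_trace * Poly_Mapping.lookup h (Id_on {1..k})"
proof -
  have "ap_class k k h = ap_class k k (ap_smult (Poly_Mapping.lookup h (Id_on {1..k})) rot_sum)"
    using eig_endo[OF h] ap_class_eq_iff[OF eig_AP[OF h] AP_smult[OF rot_sum_AP]] by blast
  then show ?thesis by (simp add: tr_smult[OF rot_sum_AP] rot_trace_def mult.commute)
qed

text \<open>Left composition with the adjoint of \<open>b\<close> keeps \<open>a\<close> an
  eigenvector, now among the endomorphisms of [k], where \<open>tr_eig\<close> applies.\<close>

lemma trace_form_eig:
  assumes a: "a \<in> eig m" and b: "b \<in> carrier (AP k m)"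
  shows "trace_form k tr a b
    = rot_trace * (\<Sum>t\<in>full_tangles k m. Poly_Mapping.lookup a t * cnj (Poly_Mapping.lookup b t))"
  unfolding trace_form_def ap_class_def[symmetric]
    tr_eig[OF eig_comp[OF a AP_adj[OF b]]] lookup_adj_comp_Id[OF eig_AP[OF a] b] ..

lemma sum_norm_eq:
  "(\<Sum>t\<in>T. Poly_Mapping.lookup a t * cnj (Poly_Mapping.lookup a t))
    = of_real (\<Sum>t\<in>T. (cmod (Poly_Mapping.lookup a t))\<^sup>2)" for a :: ap
  by (simp add: complex_mult_cnj cmod_power2)

text \<open>The trace of the adjoint of \<open>rot_sum\<close> composed with \<open>rot_sum\<close>
  is \<open>rot_trace\<close> times a sum \<open>s\<close> of squared moduli, and \<open>s\<close>
  is positive because the identity coefficient is 1. Positivity of the trace makes this product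
  nonnegative, faithfulness makes it nonzero.\<close>

lemma rot_trace_pos: obtains w where "w > 0" "rot_trace = of_real w"
proof -
  define s where "s = (\<Sum>t\<in>full_tangles k k. (cmod (Poly_Mapping.lookup rot_sum t))\<^sup>2)"
  have "(cmod (Poly_Mapping.lookup rot_sum (Id_on {1..k})))\<^sup>2 \<le> s"
    unfolding s_def by (rule member_le_sum[OF Id_on_full]) (auto simp: finite_full_tangles)
  then have s: "s > 0" by (simp only: lookup_rot_sum_Id) simp
  have eq: "tr (ap_class k k (ap_adj rot_sum \<circ>\<^sub>A rot_sum)) = rot_trace * of_real s"
    using trace_form_eig[OF rot_sum_eig rot_sum_AP]
    by (simp only: trace_form_def ap_class_def sum_norm_eq s_def)
  have "\<not> ap_cong k k rot_sum 0"
    using Id_on_full lookup_rot_sum_Id unfolding ap_cong_def by (metis lookup_zero zero_neq_one)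
  then have "rot_trace * of_real s \<in> \<real>\<^sub>\<ge>\<^sub>0" "rot_trace \<noteq> 0"
    using tr_adj_self[OF rot_sum_AP] by (auto simp: eq)
  then have "Re rot_trace > 0" "Im rot_trace = 0"
    using s by (auto simp: complex_nonneg_Reals_iff zero_le_mult_iff complex_eq_iff)
  then show thesis using that[of "Re rot_trace"] by (simp add: complex_eq_iff)
qed

end

section \<open>The modules $V^{k,\omega}$\<close>

lemma ap_submoduleD:
  assumes W: "ap_submodule W V" and V: "hilbert_ap_module V"
  shows "W n \<subseteq> carrier (space V n)" "\<zero>\<^bsub>space V n\<^esub> \<in> W n"
    and "x \<in> W n \<Longrightarrow> c \<odot>\<^bsub>space V n\<^esub> x \<in> W n"
    and "a \<in> carrier (AP m n) \<Longrightarrow> y \<in> W m \<Longrightarrow> act V m n a y \<in> W n"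
proof -
  have s: "submodule (W n) complex_ring (space V n)" using W by (simp add: ap_submodule_def)
  interpret submodule "W n" complex_ring "space V n" by (rule s)
  show "W n \<subseteq> carrier (space V n)" using subset by simp
  show "\<zero>\<^bsub>space V n\<^esub> \<in> W n" using one_closed by simp
  show "c \<odot>\<^bsub>space V n\<^esub> x \<in> W n" if "x \<in> W n" using smult_closed[of c x] that by simp
  show "act V m n a y \<in> W n" if "a \<in> carrier (AP m n)" "y \<in> W m"
    using W that unfolding ap_submodule_def by blast
qed

section \<open>The Hilbert module structure\<close>

context traced_rotation_eigenvalue
begin

abbreviation "V \<equiv> Vmod k \<omega> tr"

lemma space_V: "space V m = Vmod_space k \<omega> tr m"
  by (simp add: Vmod_def)

lemma act_V:
  assumes f: "f \<in> carrier (AP k m)" and c: "c \<in> carrier (AP m n)"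
  shows "act V m n c (ap_class k m f) = ap_class k n (c \<circ>\<^sub>A f)"
  unfolding Vmod_def ap_module.select_convs
  using AP_comp[OF _ c] ap_cong_comp_left[OF _ f c] by (intro quot_map_ap_class[OF f]) blast+

lemma carrier_V: "carrier (space V m) = ap_class k m ` eig m"
proof -
  have "quot_map (AP k m) (AI k m) (\<lambda>v. v \<circ>\<^sub>A ap_tau k) (ap_class k m f) = \<omega> \<odot>\<^bsub>APQ k m\<^esub> ap_class k m f
      \<longleftrightarrow> f \<in> eig m" if f: "f \<in> carrier (AP k m)" for f
  proof -
    have "quot_map (AP k m) (AI k m) (\<lambda>v. v \<circ>\<^sub>A ap_tau k) (ap_class k m f)
        = ap_class k m (f \<circ>\<^sub>A ap_tau k)"
      using AP_comp[OF ap_tau_AP] ap_cong_comp_right[OF _ f ap_tau_AP]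
      by (intro quot_map_ap_class[OF f]) blast+
    then show ?thesis
      unfolding APQ_smult[OF f] eig_def
      using f by (simp add: ap_class_eq_iff[OF AP_comp[OF ap_tau_AP f] AP_smult[OF f]])
  qed
  then show ?thesis
    unfolding space_V Vmod_space_def APQ_carrier by (auto intro: eig_AP)
qed

lemma zero_V: "\<zero>\<^bsub>space V m\<^esub> = ap_class k m 0"
  using APQ_zero[of k m] by (simp add: space_V Vmod_space_def)

lemma add_V:
  "f \<in> eig m \<Longrightarrow> g \<in> eig m \<Longrightarrow>
    ap_class k m f \<oplus>\<^bsub>space V m\<^esub> ap_class k m g = ap_class k m (f + g)"
  using APQ_add[OF eig_AP eig_AP, of f m g] by (simp add: space_V Vmod_space_def)

lemma smult_V:
  "f \<in> eig m \<Longrightarrow> c \<odot>\<^bsub>space V m\<^esub> ap_class k m f = ap_class k m (ap_smult c f)"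
  using APQ_smult[OF eig_AP, of f m c] by (simp add: space_V Vmod_space_def)

lemma class_V: "f \<in> eig m \<Longrightarrow> ap_class k m f \<in> carrier (space V m)"
  by (simp add: carrier_V)

text \<open>The definite description has a value because a change of representatives alters
  \<open>ap_adj b \<circ>\<^sub>A a\<close> only by lower tangles, which the trace on the quotient
  does not see.\<close>

lemma ip_V:
  assumes f: "f \<in> eig m" and g: "g \<in> eig m"
  shows "ip (space V m) (ap_class k m f) (ap_class k m g) = trace_form k tr f g"
proof -
  have cong: "trace_form k tr a b = trace_form k tr f g"
    if "a \<in> ap_class k m f" "b \<in> ap_class k m g" for a b
  proof -
    have a: "a \<in> carrier (AP k m)" "ap_cong k m a f" and b: "b \<in> carrier (AP k m)" "ap_cong k m b g"
      using that unfolding ap_class_eq[OF eig_AP[OF f]] ap_class_eq[OF eig_AP[OF g]] by blast+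
    have "ap_class k k (ap_adj b \<circ>\<^sub>A a) = ap_class k k (ap_adj g \<circ>\<^sub>A f)"
      unfolding ap_class_eq_iff[OF AP_comp[OF a(1) AP_adj[OF b(1)]]
          AP_comp[OF eig_AP[OF f] AP_adj[OF eig_AP[OF g]]]]
      by (rule ap_cong_adj_comp[OF a(1) eig_AP[OF f] a(2) b(1) eig_AP[OF g] b(2)])
    then show ?thesis by (simp add: trace_form_def ap_class_def)
  qed
  have "(THE z. \<forall>a\<in>ap_class k m f. \<forall>b\<in>ap_class k m g. z = trace_form k tr a b)
      = trace_form k tr f g"
    using cong ap_class_self[OF eig_AP[OF f]] ap_class_self[OF eig_AP[OF g]]
    by (intro the_equality) metis+
  then show ?thesis by (simp add: space_V Vmod_space_def)
qed

lemma ip_V_sum: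
  assumes "f \<in> eig m" "g \<in> eig m"
  shows "ip (space V m) (ap_class k m f) (ap_class k m g)
    = rot_trace * (\<Sum>t\<in>full_tangles k m. Poly_Mapping.lookup f t * cnj (Poly_Mapping.lookup g t))"
  using ip_V[OF assms] trace_form_eig[OF assms(1) eig_AP[OF assms(2)]] by simp

lemma module_V: "Module.module complex_ring (space V m)"
proof (rule moduleI[OF cring_complex_ring])
  show "abelian_group (space V m)"
  proof (rule abelian_groupI)
    fix x assume "x \<in> carrier (space V m)"
    then obtain f where f: "f \<in> eig m" "x = ap_class k m f" by (auto simp: carrier_V)
    show "\<exists>y\<in>carrier (space V m). y \<oplus>\<^bsub>space V m\<^esub> x = \<zero>\<^bsub>space V m\<^esub>"
    proof
      show "ap_class k m (ap_smult (- 1) f) \<in> carrier (space V m)"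
        by (rule class_V[OF eig_smult[OF f(1)]])
      have "ap_smult (- 1) f + f = 0" by (rule poly_mapping_eqI) (simp add: lookup_add)
      then show "ap_class k m (ap_smult (- 1) f) \<oplus>\<^bsub>space V m\<^esub> x = \<zero>\<^bsub>space V m\<^esub>"
        unfolding f(2) add_V[OF eig_smult[OF f(1)] f(1)] zero_V by simp
    qed
  qed (auto simp: carrier_V zero_V add_V eig_add eig_zero add.assoc add.commute add.left_commute)
next
  have distrib: "ap_smult (a + b) f = ap_smult a f + ap_smult b f" for a b f
    by (rule poly_mapping_eqI) (simp add: lookup_add distrib_right)
  have assoc: "ap_smult (a * b) f = ap_smult a (ap_smult b f)" for a b f
    by (rule poly_mapping_eqI) (simp add: mult.assoc)
  have one: "ap_smult 1 f = f" for f
    by (rule poly_mapping_eqI) (simp only: lookup_ap_smult mult_1)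
  fix a b x y
  assume x: "x \<in> carrier (space V m)" and y: "y \<in> carrier (space V m)"
  obtain f g where f: "f \<in> eig m" "x = ap_class k m f" and g: "g \<in> eig m" "y = ap_class k m g"
    using x y by (auto simp: carrier_V)
  show "a \<odot>\<^bsub>space V m\<^esub> x \<in> carrier (space V m)"
    by (simp only: f(2) smult_V[OF f(1)] class_V[OF eig_smult[OF f(1)]])
  show "(a \<oplus>\<^bsub>complex_ring\<^esub> b) \<odot>\<^bsub>space V m\<^esub> x
      = a \<odot>\<^bsub>space V m\<^esub> x \<oplus>\<^bsub>space V m\<^esub> b \<odot>\<^bsub>space V m\<^esub> x"
    by (simp add: f(2) smult_V[OF f(1)] add_V[OF eig_smult[OF f(1)] eig_smult[OF f(1)]] distrib)
  show "a \<odot>\<^bsub>space V m\<^esub> (x \<oplus>\<^bsub>space V m\<^esub> y)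
      = a \<odot>\<^bsub>space V m\<^esub> x \<oplus>\<^bsub>space V m\<^esub> a \<odot>\<^bsub>space V m\<^esub> y"
    by (simp add: f(2) g(2) add_V[OF f(1) g(1)] smult_V[OF f(1)] smult_V[OF g(1)]
        smult_V[OF eig_add[OF f(1) g(1)]] add_V[OF eig_smult[OF f(1)] eig_smult[OF g(1)]]
        ap_smult_add)
  show "(a \<otimes>\<^bsub>complex_ring\<^esub> b) \<odot>\<^bsub>space V m\<^esub> x = a \<odot>\<^bsub>space V m\<^esub> (b \<odot>\<^bsub>space V m\<^esub> x)"
    by (simp add: f(2) smult_V[OF f(1)] smult_V[OF eig_smult[OF f(1)]] assoc)
  show "\<one>\<^bsub>complex_ring\<^esub> \<odot>\<^bsub>space V m\<^esub> x = x"
    by (simp only: f(2) smult_V[OF f(1)] complex_ring_simps one)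
qed

text \<open>One vector generates the module: every class is, up to a scalar, its own representative
  applied to the class of \<open>rot_sum\<close>. Both finite dimension and irreducibility rest on
  this.\<close>

lemma class_eq_smult_rot_sum:
  assumes f: "f \<in> eig m"
  shows "ap_class k m f = inverse (of_nat (max 1 k)) \<odot>\<^bsub>space V m\<^esub> ap_class k m (f \<circ>\<^sub>A rot_sum)"
proof -
  have e: "f \<circ>\<^sub>A rot_sum \<in> eig m" by (rule eig_comp[OF rot_sum_eig eig_AP[OF f]])
  have nz: "of_nat (max 1 k) \<noteq> (0::complex)" by (simp del: of_nat_max)
  have "ap_cong k m f (ap_smult (inverse (of_nat (max 1 k))) (f \<circ>\<^sub>A rot_sum))"
    using eig_comp_rot_sum[OF f] nz by (simp add: ap_cong_def del: of_nat_max)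
  then show ?thesis
    unfolding smult_V[OF e] using ap_class_eq_iff[OF eig_AP[OF f] AP_smult[OF eig_AP[OF e]]] by blast
qed

text \<open>Single tangles are in general not eigenvectors, so they are symmetrized by
  \<open>rot_sum\<close>. The spanning claim concerns \<open>f \<circ>\<^sub>A rot_sum\<close> for
  arbitrary \<open>f\<close>, which permits induction over tangles; only afterwards is
  \<open>f\<close> taken to be an eigenvector.\<close>

lemma finite_dim_V:
  "\<exists>B. finite B \<and> B \<subseteq> carrier (space V m) \<and>
    (\<forall>x\<in>carrier (space V m). \<exists>c. x = (\<Oplus>\<^bsub>space V m\<^esub>b\<in>B. c b \<odot>\<^bsub>space V m\<^esub> b))"
proof -
  have e: "g \<circ>\<^sub>A rot_sum \<in> eig m" if "g \<in> carrier (AP k m)" for g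
    by (rule eig_comp[OF rot_sum_eig that])
  define B where "B = (\<lambda>t. ap_class k m (tangle_elem t \<circ>\<^sub>A rot_sum)) ` tangles k m"
  have B: "finite B" "B \<subseteq> carrier (space V m)"
    using finite_tangles[of k m] AP_single[of _ k m 1] e class_V by (auto simp: B_def)
  note span = lin_span_add[OF module_V B] lin_span_smult[OF module_V B] lin_span_zero[OF module_V B]
    lin_span_superset[OF module_V B]
  have "ap_class k m (f \<circ>\<^sub>A rot_sum) \<in> lin_span (space V m) B"
    if "Poly_Mapping.keys f \<subseteq> tangles k m" for f
    using that
  proof (induction f rule: ap_induct)
    case zero
    then show ?case using span(3) by (simp add: zero_V)
  next
    case (single t c)
    have t: "tangle_elem t \<in> carrier (AP k m)" using single by (rule AP_single)
    have "Poly_Mapping.single t c = ap_smult c (tangle_elem t)" by (simp add: map_single)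
    then have "ap_class k m (Poly_Mapping.single t c \<circ>\<^sub>A rot_sum)
        = c \<odot>\<^bsub>space V m\<^esub> ap_class k m (tangle_elem t \<circ>\<^sub>A rot_sum)"
      by (simp only: ap_comp_smult_left smult_V[OF e[OF t]])
    then show ?case using span(2,4) single by (simp add: B_def)
  next
    case (add f g)
    then have "f \<in> carrier (AP k m)" "g \<in> carrier (AP k m)" by (simp_all add: AP_simps(1))
    then show ?case
      using span(1)[OF add.IH] by (simp only: ap_comp_add_left add_V[OF e e])
  qed
  then have "ap_class k m f \<in> lin_span (space V m) B" if "f \<in> eig m" for f
    unfolding class_eq_smult_rot_sum[OF that] using eig_AP[OF that]
    by (intro span(2)) (simp add: AP_simps(1))
  then show ?thesis
    using B unfolding carrier_V lin_span_def by blast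
qed

text \<open>The inner product axioms are read off from \<open>ip_V_sum\<close>: its factor
  \<open>w\<close> is a positive real, and a vanishing norm makes all coefficients of full tangles
  vanish.\<close>

lemma fd_hilbert_space_V: "fd_hilbert_space (space V m)"
proof -
  obtain w where w: "w > 0" "rot_trace = of_real w" by (rule rot_trace_pos)
  show ?thesis
  proof (intro fd_hilbert_space.intro fd_hilbert_space_axioms.intro)
    show "Module.module complex_ring (space V m)" by (rule module_V)
  next
    fix x y z :: "ap set" and c :: complex
    assume x: "x \<in> carrier (space V m)"
    then obtain f where f: "f \<in> eig m" "x = ap_class k m f" by (auto simp: carrier_V)
    have norm: "ip (space V m) x x
        = of_real (w * (\<Sum>t\<in>full_tangles k m. (cmod (Poly_Mapping.lookup f t))\<^sup>2))"
      by (simp only: f(2) ip_V_sum[OF f(1) f(1)] sum_norm_eq w(2) of_real_mult)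
    have nonneg: "(\<Sum>t\<in>full_tangles k m. (cmod (Poly_Mapping.lookup f t))\<^sup>2) \<ge> 0"
      by (rule sum_nonneg) simp
    show "ip (space V m) x x \<in> \<real>\<^sub>\<ge>\<^sub>0"
      unfolding norm nonneg_Reals_of_real_iff using w nonneg by simp
    show "x = \<zero>\<^bsub>space V m\<^esub>" if "ip (space V m) x x = 0"
    proof -
      have "(\<Sum>t\<in>full_tangles k m. (cmod (Poly_Mapping.lookup f t))\<^sup>2) = 0"
        using that w(1) unfolding norm of_real_eq_0_iff by simp
      then have "ap_cong k m f 0"
        using finite_full_tangles by (simp add: ap_cong_def sum_nonneg_eq_0_iff)
      then show ?thesis by (simp only: f(2) zero_V ap_class_eq_iff[OF eig_AP[OF f(1)] AP_zero])
    qed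
    assume y: "y \<in> carrier (space V m)"
    then obtain g where g: "g \<in> eig m" "y = ap_class k m g" by (auto simp: carrier_V)
    show "ip (space V m) (c \<odot>\<^bsub>space V m\<^esub> x) y = c * ip (space V m) x y"
      unfolding f(2) g(2) smult_V[OF f(1)] ip_V_sum[OF f(1) g(1)] ip_V_sum[OF eig_smult[OF f(1)] g(1)]
      by (simp add: sum_distrib_left mult.assoc mult.left_commute)
    show "ip (space V m) y x = cnj (ip (space V m) x y)"
      unfolding f(2) g(2) ip_V_sum[OF f(1) g(1)] ip_V_sum[OF g(1) f(1)] w(2)
      by (simp add: mult.commute)
    assume z: "z \<in> carrier (space V m)"
    then obtain h where h: "h \<in> eig m" "z = ap_class k m h" by (auto simp: carrier_V)
    show "ip (space V m) (x \<oplus>\<^bsub>space V m\<^esub> y) z = ip (space V m) x z + ip (space V m) y z"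
      unfolding f(2) g(2) h(2) add_V[OF f(1) g(1)] ip_V_sum[OF f(1) h(1)] ip_V_sum[OF g(1) h(1)]
        ip_V_sum[OF eig_add[OF f(1) g(1)] h(1)]
      by (simp add: lookup_add distrib_right sum.distrib distrib_left)
  next
    show "\<exists>B. finite B \<and> B \<subseteq> carrier (space V m) \<and>
      (\<forall>x\<in>carrier (space V m). \<exists>c. x = (\<Oplus>\<^bsub>space V m\<^esub>b\<in>B. c b \<odot>\<^bsub>space V m\<^esub> b))"
      by (rule finite_dim_V)
  qed
qed

lemma hilbert_ap_module_V: "hilbert_ap_module V"
proof (rule hilbert_ap_module.intro)
  fix n show "fd_hilbert_space (space V n)" by (rule fd_hilbert_space_V)
next
  fix a m n assume a: "a \<in> carrier (AP m n)"
  show "act V m n a \<in> linear_maps (space V m) (space V n)"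
    unfolding linear_maps_def carrier_V
    by (auto simp: act_V[OF eig_AP a] add_V smult_V eig_add eig_smult eig_comp[OF _ a]
        ap_comp_add_right ap_comp_smult_right)
next
  fix a b m n x
  assume a: "a \<in> carrier (AP m n)" and b: "b \<in> carrier (AP m n)" and x: "x \<in> carrier (space V m)"
  then show "act V m n (a \<oplus>\<^bsub>AP m n\<^esub> b) x = act V m n a x \<oplus>\<^bsub>space V n\<^esub> act V m n b x"
    by (auto simp: carrier_V act_V[OF eig_AP] AP_add add_V eig_comp ap_comp_add_left)
next
  fix a m n x c
  assume "a \<in> carrier (AP m n)" "x \<in> carrier (space V m)"
  then show "act V m n (c \<odot>\<^bsub>AP m n\<^esub> a) x = c \<odot>\<^bsub>space V n\<^esub> act V m n a x"
    by (auto simp: carrier_V act_V[OF eig_AP] AP_smult smult_V eig_comp ap_comp_smult_left)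
next
  fix x n assume "x \<in> carrier (space V n)"
  moreover have "ap_id n \<in> carrier (AP n n)"
    unfolding ap_id_def by (intro AP_single Id_on_tangles) simp
  ultimately show "act V n n (ap_id n) x = x"
    by (auto simp: carrier_V act_V[OF eig_AP] ap_comp_id_left[OF eig_AP])
next
  fix a b l m n x
  assume a: "a \<in> carrier (AP l m)" and b: "b \<in> carrier (AP m n)" and "x \<in> carrier (space V l)"
  then obtain f where f: "f \<in> carrier (AP k l)" "x = ap_class k l f"
    unfolding carrier_V using eig_AP by blast
  show "act V l n (b \<circ>\<^sub>A a) x = act V m n b (act V l m a x)"
    unfolding f(2) act_V[OF f(1) AP_comp[OF a b]] act_V[OF f(1) a] act_V[OF AP_comp[OF f(1) a] b]
      ap_comp_assoc ..
next
  fix a m n x y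
  assume a: "a \<in> carrier (AP m n)" and x: "x \<in> carrier (space V m)" and y: "y \<in> carrier (space V n)"
  obtain f g where f: "f \<in> eig m" "x = ap_class k m f" and g: "g \<in> eig n" "y = ap_class k n g"
    using x y by (auto simp: carrier_V)
  \<comment> \<open>Both sides are the trace of the same composite, \<open>ap_adj g\<close> after
    \<open>a\<close> after \<open>f\<close>.\<close>
  show "ip (space V n) (act V m n a x) y = ip (space V m) x (act V n m (ap_adj a) y)"
    unfolding f(2) g(2) act_V[OF eig_AP[OF f(1)] a] act_V[OF eig_AP[OF g(1)] AP_adj[OF a]]
      ip_V[OF eig_comp[OF f(1) a] g(1)] ip_V[OF f(1) eig_comp[OF g(1) AP_adj[OF a]]]
    by (simp add: trace_form_def ap_adj_comp ap_comp_assoc)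
qed

section \<open>Irreducibility and weight\<close>

lemma rot_sum_nonzero_V: "ap_class k k rot_sum \<noteq> \<zero>\<^bsub>space V k\<^esub>"
  unfolding zero_V ap_class_eq_iff[OF rot_sum_AP AP_zero] ap_cong_def
  using Id_on_full lookup_rot_sum_Id by (metis lookup_zero zero_neq_one)

lemma irreducible_V: "irreducible_ap_module V"
  unfolding irreducible_ap_module_def
proof (intro conjI allI impI)
  show "hilbert_ap_module V" by (rule hilbert_ap_module_V)
  show "\<exists>n. carrier (space V n) \<noteq> {\<zero>\<^bsub>space V n\<^esub>}"
    using rot_sum_nonzero_V class_V[OF rot_sum_eig] by blast
  fix W assume "ap_submodule W V"
  note W = ap_submoduleD[OF this hilbert_ap_module_V]
  show "(\<forall>n. W n = {\<zero>\<^bsub>space V n\<^esub>}) \<or> (\<forall>n. W n = carrier (space V n))"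
  proof (rule disjCI)
    \<comment> \<open>Some \<open>W m\<close> is proper; a nonzero vector anywhere in
      \<open>W\<close> would fill it.\<close>
    assume "\<not> (\<forall>n. W n = carrier (space V n))"
    then obtain m where m: "W m \<noteq> carrier (space V m)" by blast
    have "x = \<zero>\<^bsub>space V n\<^esub>" if x: "x \<in> W n" for n x
    proof (rule ccontr)
      assume nz: "x \<noteq> \<zero>\<^bsub>space V n\<^esub>"
      obtain f where f: "f \<in> eig n" "x = ap_class k n f"
        using x W(1)[of n] by (auto simp: carrier_V)
      then obtain t where t: "t \<in> full_tangles k n" "Poly_Mapping.lookup f t \<noteq> 0"
        using nz by (auto simp: zero_V ap_class_eq_iff[OF eig_AP[OF f(1)] AP_zero] ap_cong_def)
      note f' = eig_AP[OF f(1)]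
      have t': "tangle_elem t \<in> carrier (AP k n)"
        by (rule AP_single[OF full_tangles_tangle[OF t(1)]])
      \<comment> \<open>The adjoint of \<open>t\<close> moves the nonzero coefficient of
        \<open>f\<close> at \<open>t\<close> to the identity coefficient of an element of
        \<open>eig k\<close>; divided by it, this element becomes congruent to
        \<open>rot_sum\<close>.\<close>
      define h where "h = ap_adj (tangle_elem t) \<circ>\<^sub>A f"
      have h: "h \<in> eig k" unfolding h_def by (rule eig_comp[OF f(1) AP_adj[OF t']])
      have "Poly_Mapping.lookup h (Id_on {1..k})
          = (\<Sum>s\<in>full_tangles k n. if s = t then Poly_Mapping.lookup f t else 0)"
        unfolding h_def lookup_adj_comp_Id[OF f' t']
        by (intro sum.cong) (auto simp: lookup_single when_def)
      then have hId: "Poly_Mapping.lookup h (Id_on {1..k}) = Poly_Mapping.lookup f t"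
        using t(1) finite_full_tangles by simp
      have "ap_class k k h \<in> W k"
        using W(4)[OF AP_adj[OF t'] x] by (simp only: f(2) act_V[OF f' AP_adj[OF t']] h_def)
      then have "inverse (Poly_Mapping.lookup f t) \<odot>\<^bsub>space V k\<^esub> ap_class k k h \<in> W k" by (rule W(3))
      moreover have "ap_cong k k (ap_smult (inverse (Poly_Mapping.lookup f t)) h) rot_sum"
        using eig_endo[OF h] t(2) by (simp add: hId[simplified] ap_cong_def)
      ultimately have e: "ap_class k k rot_sum \<in> W k"
        unfolding smult_V[OF h] using ap_class_eq_iff[OF AP_smult[OF eig_AP[OF h]] rot_sum_AP] by metis
      \<comment> \<open>Apply \<open>g\<close> itself to the class of \<open>rot_sum\<close> and
        rescale.\<close>
      have "ap_class k m g \<in> W m" if g: "g \<in> eig m" for g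
        unfolding class_eq_smult_rot_sum[OF g]
        using W(4)[OF eig_AP[OF g] e] by (intro W(3)) (simp only: act_V[OF rot_sum_AP eig_AP[OF g]])
      then show False using m W(1)[of m] unfolding carrier_V by blast
    qed
    then show "\<forall>n. W n = {\<zero>\<^bsub>space V n\<^esub>}" using W(2) by blast
  qed
qed

lemma weight_V: "weight V = k"
  unfolding weight_def
proof (rule Least_equality)
  show "carrier (space V k) \<noteq> {\<zero>\<^bsub>space V k\<^esub>}"
    using rot_sum_nonzero_V class_V[OF rot_sum_eig] by blast
  fix n assume n: "carrier (space V n) \<noteq> {\<zero>\<^bsub>space V n\<^esub>}"
  show "k \<le> n"
  proof (rule ccontr)
    assume "\<not> k \<le> n"
    \<comment> \<open>With fewer than \<open>k\<close> outer points no tangle has \<open>k\<close>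
      through strings, so every class is zero.\<close>
    then have "full_tangles k n = {}"
      using card_tangle_le(2)[of _ k n] by (auto simp: full_tangles_def)
    then have "ap_class k n f = ap_class k n 0" if "f \<in> eig n" for f
      using ap_class_eq_iff[OF eig_AP[OF that] AP_zero] by (simp add: ap_cong_def)
    then show False using n eig_zero unfolding carrier_V zero_V by blast
  qed
qed

end

section \<open>Classification\<close>

lemma unitaries_inv_into:
  assumes H: "fd_hilbert_space H" and u: "u \<in> unitaries H K"
  shows "inv_into (carrier H) u \<in> unitaries K H"
proof -
  interpret fd_hilbert_space H by (rule H)
  let ?v = "inv_into (carrier H) u"
  have bij: "bij_betw u (carrier H) (carrier K)"
    and ip: "\<And>x y. x \<in> carrier H \<Longrightarrow> y \<in> carrier H \<Longrightarrow> ip K (u x) (u y) = ip H x y"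
    and add: "\<And>x y. x \<in> carrier H \<Longrightarrow> y \<in> carrier H \<Longrightarrow> u (x \<oplus>\<^bsub>H\<^esub> y) = u x \<oplus>\<^bsub>K\<^esub> u y"
    and smult: "\<And>c x. x \<in> carrier H \<Longrightarrow> u (c \<odot>\<^bsub>H\<^esub> x) = c \<odot>\<^bsub>K\<^esub> u x"
    using u by (auto simp: unitaries_def linear_maps_def)
  have v: "?v x \<in> carrier H" "u (?v x) = x" if "x \<in> carrier K" for x
    using that bij by (auto simp: bij_betw_def inv_into_into f_inv_into_f)
  have vu: "?v (u x) = x" if "x \<in> carrier H" for x
    using that bij by (simp add: bij_betw_def)
  have "?v (x \<oplus>\<^bsub>K\<^esub> y) = ?v x \<oplus>\<^bsub>H\<^esub> ?v y" if "x \<in> carrier K" "y \<in> carrier K" for x y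
    using vu[of "?v x \<oplus>\<^bsub>H\<^esub> ?v y"] add[of "?v x" "?v y"] v[OF that(1)] v[OF that(2)] by simp
  moreover have "?v (c \<odot>\<^bsub>K\<^esub> x) = c \<odot>\<^bsub>H\<^esub> ?v x" if "x \<in> carrier K" for c x
    using vu[of "c \<odot>\<^bsub>H\<^esub> ?v x"] smult[of "?v x" c] v[OF that] smult_closed[of c "?v x"] by simp
  moreover have "ip H (?v x) (?v y) = ip K x y" if "x \<in> carrier K" "y \<in> carrier K" for x y
    using ip[of "?v x" "?v y"] v[OF that(1)] v[OF that(2)] by simp
  ultimately show ?thesis
    using v(1) bij_betw_inv_into[OF bij] by (auto simp: unitaries_def linear_maps_def)
qed

text \<open>The isomorphism constructed below starts at \<open>Vmod\<close>, whereas the theorem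
  asks for one that ends there.\<close>

lemma ap_module_iso_sym:
  assumes V: "hilbert_ap_module V" and iso: "ap_module_iso V W"
  shows "ap_module_iso W V"
proof -
  interpret V: hilbert_ap_module V by (rule V)
  obtain u where u: "\<And>n. u n \<in> unitaries (space V n) (space W n)"
    and nat: "\<And>m n a x. a \<in> carrier (AP m n) \<Longrightarrow> x \<in> carrier (space V m) \<Longrightarrow>
      u n (act V m n a x) = act W m n a (u m x)"
    using iso unfolding ap_module_iso_def by blast
  define v where "v n = inv_into (carrier (space V n)) (u n)" for n
  have bij: "bij_betw (u n) (carrier (space V n)) (carrier (space W n))" for n
    using u[of n] by (simp add: unitaries_def)
  have "v n (act W m n a y) = act V m n a (v m y)"
    if a: "a \<in> carrier (AP m n)" and y: "y \<in> carrier (space W m)" for m n a y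
  proof -
    have vy: "v m y \<in> carrier (space V m)" "u m (v m y) = y"
      using y bij[of m] by (auto simp: v_def bij_betw_def inv_into_into f_inv_into_f)
    have "act V m n a (v m y) \<in> carrier (space V n)"
      using V.act_linear[OF a] vy(1) by (auto simp: linear_maps_def)
    then have "v n (u n (act V m n a (v m y))) = act V m n a (v m y)"
      using bij[of n] by (simp add: v_def bij_betw_def)
    then show ?thesis using nat[OF a vy(1)] vy(2) by simp
  qed
  moreover have "v n \<in> unitaries (space W n) (space V n)" for n
    unfolding v_def by (rule unitaries_inv_into[OF V.hilbert u])
  ultimately show ?thesis unfolding ap_module_iso_def by blast
qed

text \<open>Orthogonality of the characters of a cyclic group: for \<open>j \<noteq> 0\<close> the
  sum is a geometric series whose ratio is a root of unity other than 1.\<close>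

lemma sum_roots_unity_power:
  assumes "j < n"
  shows "(\<Sum>l<n. inverse (cis (2 * pi * real l / real n)) ^ j) = (if j = 0 then of_nat n else 0)"
proof (cases "j = 0")
  case False
  define z where "z = inverse (cis (2 * pi * real j / real n))"
  have n: "n > 0" using assms by simp
  \<comment> \<open>The exponents \<open>j\<close> and \<open>l\<close> enter symmetrically, so a
    fixed power of all roots becomes all powers of the one root \<open>z\<close>.\<close>
  have eq: "inverse (cis (2 * pi * real l / real n)) ^ j = z ^ l" for l
    by (simp add: z_def power_inverse DeMoivre mult.commute mult.left_commute)
  have "cis (2 * pi * real j / real n) ^ n = 1"
    using bij_betw_roots_unity[OF n] assms by (auto simp: bij_betw_def)
  then have "z ^ n = 1" by (simp only: z_def power_inverse inverse_1)
  moreover have "inj_on (\<lambda>k. cis (2 * pi * real k / real n)) {..<n}"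
    using bij_betw_roots_unity[OF n] by (simp add: bij_betw_def)
  then have "cis (2 * pi * real j / real n) \<noteq> cis (2 * pi * real 0 / real n)"
    using inj_on_eq_iff[of _ "{..<n}" j 0] assms False n by blast
  then have "cis (2 * pi * real j / real n) \<noteq> 1" by simp
  then have "z \<noteq> 1" by (simp only: z_def inverse_eq_1_iff not_False_eq_True)
  ultimately show ?thesis unfolding eq using False by (simp add: geometric_sum)
qed simp

section \<open>The action on the lowest nonzero space\<close>

context hilbert_ap_module
begin

lemma module_space: "Module.module complex_ring (space V n)"
  using hilbert fd_hilbert_space.axioms(1) by blast

lemma act_closed:
  "a \<in> carrier (AP m n) \<Longrightarrow> x \<in> carrier (space V m) \<Longrightarrow> act V m n a x \<in> carrier (space V n)"
  using act_linear unfolding linear_maps_def by blast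

lemma act_smult_vector:
  "a \<in> carrier (AP m n) \<Longrightarrow> x \<in> carrier (space V m) \<Longrightarrow>
    act V m n a (c \<odot>\<^bsub>space V m\<^esub> x) = c \<odot>\<^bsub>space V n\<^esub> act V m n a x"
  using act_linear unfolding linear_maps_def by blast

lemma act_zero_vector:
  assumes a: "a \<in> carrier (AP m n)"
  shows "act V m n a \<zero>\<^bsub>space V m\<^esub> = \<zero>\<^bsub>space V n\<^esub>"
proof -
  interpret m: Module.module complex_ring "space V m" by (rule module_space)
  interpret n: Module.module complex_ring "space V n" by (rule module_space)
  have "act V m n a (0 \<odot>\<^bsub>space V m\<^esub> \<zero>\<^bsub>space V m\<^esub>) = 0 \<odot>\<^bsub>space V n\<^esub> act V m n a \<zero>\<^bsub>space V m\<^esub>"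
    by (rule act_smult_vector[OF a]) simp
  then show ?thesis
    using m.smult_l_null[of "\<zero>\<^bsub>space V m\<^esub>"] n.smult_l_null[OF act_closed[OF a]] by simp
qed

lemma act_zero:
  assumes x: "x \<in> carrier (space V m)"
  shows "act V m n 0 x = \<zero>\<^bsub>space V n\<^esub>"
proof -
  interpret n: Module.module complex_ring "space V n" by (rule module_space)
  have "act V m n (0 \<odot>\<^bsub>AP m n\<^esub> 0) x = 0 \<odot>\<^bsub>space V n\<^esub> act V m n 0 x"
    by (rule act_smult[OF AP_zero x])
  then show ?thesis using n.smult_l_null[OF act_closed[OF AP_zero x]] by simp
qed

lemma act_sum_zero:
  assumes x: "x \<in> carrier (space V m)" and "finite I"
    and f: "\<And>i. i \<in> I \<Longrightarrow> f i \<in> carrier (AP m n) \<and> act V m n (f i) x = \<zero>\<^bsub>space V n\<^esub>"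
  shows "act V m n (\<Sum>i\<in>I. f i) x = \<zero>\<^bsub>space V n\<^esub>"
  using assms(2) f
proof (induction I)
  case empty
  then show ?case by (simp add: act_zero[OF x])
next
  case (insert i I)
  interpret n: Module.module complex_ring "space V n" by (rule module_space)
  have "act V m n (f i \<oplus>\<^bsub>AP m n\<^esub> sum f I) x = act V m n (f i) x \<oplus>\<^bsub>space V n\<^esub> act V m n (sum f I) x"
    using insert.prems by (intro act_add x AP_sum) auto
  then show ?case using insert by simp
qed

text \<open>By \<open>tangles_factor\<close>, a tangle with fewer than \<open>k\<close> through
  strings passes through an object whose space is zero.\<close>

lemma act_AI:
  assumes low: "\<And>j. j < k \<Longrightarrow> carrier (space V j) = {\<zero>\<^bsub>space V j\<^esub>}"
    and x: "x \<in> carrier (space V k)" and f: "f \<in> AI k m"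
  shows "act V k m f x = \<zero>\<^bsub>space V m\<^esub>"
proof -
  interpret m: Module.module complex_ring "space V m" by (rule module_space)
  have "Poly_Mapping.keys f \<subseteq> {t \<in> tangles k m. card t < k}" using f by (simp add: AI_def)
  then show ?thesis
  proof (induction f rule: ap_induct)
    case zero
    then show ?case by (rule act_zero[OF x])
  next
    case (single t c)
    then have t: "t \<in> tangles k m" "card t < k" by simp_all
    obtain s r where s: "s \<in> tangles k (card t)" and r: "r \<in> tangles (card t) m" and t': "t = s O r"
      by (rule tangles_factor[OF t(1)])
    have "Poly_Mapping.single t c = Poly_Mapping.single r c \<circ>\<^sub>A tangle_elem s" by (simp add: t'[symmetric])
    moreover have "act V k (card t) (tangle_elem s) x = \<zero>\<^bsub>space V (card t)\<^esub>"
      using act_closed[OF AP_single[OF s] x] low[OF t(2)] by blast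
    ultimately show ?case
      using act_comp[OF AP_single[OF s] AP_single[OF r] x] act_zero_vector[OF AP_single[OF r]] by metis
  next
    case (add f g)
    then have "f \<in> carrier (AP k m)" "g \<in> carrier (AP k m)" by (auto simp: AP_simps(1))
    from act_add[OF this x] show ?case using add.IH by simp
  qed
qed

text \<open>Through this, classes in the quotient act on vectors of the weight space.\<close>

lemma act_cong:
  assumes low: "\<And>j. j < k \<Longrightarrow> carrier (space V j) = {\<zero>\<^bsub>space V j\<^esub>}"
    and x: "x \<in> carrier (space V k)" and f: "f \<in> carrier (AP k m)" and g: "g \<in> carrier (AP k m)"
    and fg: "ap_cong k m f g"
  shows "act V k m f x = act V k m g x"
proof -
  interpret m: Module.module complex_ring "space V m" by (rule module_space)
  have "act V k m (f - g) x = \<zero>\<^bsub>space V m\<^esub>"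
    using fg unfolding ap_cong_iff_AI[OF f g] by (intro act_AI[OF low x])
  then show ?thesis
    using act_add[OF AP_diff[OF f g] g x] act_closed[OF g x] by simp
qed

text \<open>The averages over the rotation group, taken over all characters, add up to a multiple of
  the identity, so they cannot all annihilate a nonzero vector.\<close>

lemma exists_rotation_eigenvalue:
  assumes x: "x \<in> carrier (space V k)" "x \<noteq> \<zero>\<^bsub>space V k\<^esub>"
  obtains \<omega> where "rotation_eigenvalue k \<omega>"
    "act V k k (rotation_eigenvalue.rot_sum k \<omega>) x \<noteq> \<zero>\<^bsub>space V k\<^esub>"
proof -
  interpret k: Module.module complex_ring "space V k" by (rule module_space)
  define N where "N = max 1 k"
  define z where "z l = cis (2 * pi * real l / real N)" for l
  have N: "N > 0" by (simp add: N_def)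
  have root: "rotation_eigenvalue k (z l)" if "l < N" for l
    using bij_betw_roots_unity[OF N] that
    by unfold_locales (auto simp: N_def z_def bij_betw_def)
  let ?e = "\<lambda>l. rotation_eigenvalue.rot_sum k (z l)"
  have "(\<Sum>l<N. ?e l) = (\<Sum>l<N. \<Sum>j<N. Poly_Mapping.single (rot k j) (inverse (z l) ^ j))"
    by (intro sum.cong refl) (simp add: rotation_eigenvalue.rot_sum_def[OF root] N_def)
  \<comment> \<open>After the exchange, the coefficient of the rotation by \<open>j\<close> is a
    full character sum, which vanishes unless \<open>j = 0\<close>.\<close>
  also have "\<dots> = (\<Sum>j<N. \<Sum>l<N. Poly_Mapping.single (rot k j) (inverse (z l) ^ j))"
    by (rule sum.swap)
  also have "\<dots> = (\<Sum>j<N. Poly_Mapping.single (rot k j) (\<Sum>l<N. inverse (z l) ^ j))"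
    by (intro sum.cong refl poly_mapping_eqI) (simp add: lookup_sum lookup_single when_def)
  also have "\<dots> = (\<Sum>j<N. if j = 0 then Poly_Mapping.single (rot k 0) (of_nat N) else 0)"
    unfolding z_def by (intro sum.cong refl) (simp only: sum_roots_unity_power lessThan_iff, simp)
  also have "\<dots> = ap_smult (of_nat N) (ap_id k)"
    using N by (simp add: ap_id_def rot_0 map_single)
  finally have sum: "(\<Sum>l<N. ?e l) = of_nat N \<odot>\<^bsub>AP k k\<^esub> ap_id k" by simp
  have id: "ap_id k \<in> carrier (AP k k)"
    unfolding ap_id_def by (intro AP_single Id_on_tangles) simp
  have nz: "of_nat N \<odot>\<^bsub>space V k\<^esub> x \<noteq> \<zero>\<^bsub>space V k\<^esub>"
  proof
    assume "of_nat N \<odot>\<^bsub>space V k\<^esub> x = \<zero>\<^bsub>space V k\<^esub>"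
    then have "inverse (of_nat N) \<odot>\<^bsub>space V k\<^esub> (of_nat N \<odot>\<^bsub>space V k\<^esub> x) = \<zero>\<^bsub>space V k\<^esub>"
      using k.smult_r_null by simp
    then show False
      using N x k.smult_assoc1[of "inverse (of_nat N)" "of_nat N" x] k.smult_one[OF x(1)] by simp
  qed
  have "\<exists>l<N. act V k k (?e l) x \<noteq> \<zero>\<^bsub>space V k\<^esub>"
  proof (rule ccontr)
    assume "\<not> ?thesis"
    then have "act V k k (\<Sum>l<N. ?e l) x = \<zero>\<^bsub>space V k\<^esub>"
      using rotation_eigenvalue.rot_sum_AP[OF root] by (intro act_sum_zero[OF x(1)]) auto
    then show False using nz act_smult[OF id x(1)] act_id[OF x(1)] unfolding sum by simp
  qed
  then show thesis using that root by blast
qed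

end

section \<open>The isomorphism onto an irreducible module\<close>

context traced_rotation_eigenvalue
begin

text \<open>\<open>fixed\<close> says that \<xi> lies in the image of the eigenprojection, and
  \<open>norm\<close> is the normalization under which sending the class of \<open>f\<close> to
  \<open>f\<close> applied to \<xi> is isometric. Injectivity then follows from definiteness,
  surjectivity from irreducibility.\<close>

lemma ap_module_iso_from_V:
  fixes U :: "'v ap_module"
  assumes irr: "irreducible_ap_module U"
    and low: "\<And>j. j < k \<Longrightarrow> carrier (space U j) = {\<zero>\<^bsub>space U j\<^esub>}"
    and \<xi>: "\<xi> \<in> carrier (space U k)"
    and fixed: "act U k k rot_sum \<xi> = of_nat (max 1 k) \<odot>\<^bsub>space U k\<^esub> \<xi>"
    and norm: "of_nat (max 1 k) * ip (space U k) \<xi> \<xi> = rot_trace"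
  shows "ap_module_iso V U"
proof -
  interpret hilbert_ap_module U using irr by (simp add: irreducible_ap_module_def)
  interpret H: fd_hilbert_space "space U n" for n by (rule hilbert)
  obtain w where w: "w > 0" "rot_trace = of_real w" by (rule rot_trace_pos)
  \<comment> \<open>Moving \<open>g\<close> across the inner product leaves \<open>h\<close>, which
    is \<open>c\<close> times \<open>rot_sum\<close> modulo lower tangles, and these kill \<xi>. By
    \<open>fixed\<close> and \<open>norm\<close> both sides equal
    \<open>c * rot_trace\<close>.\<close>
  have isom: "ip (space U m) (act U k m f \<xi>) (act U k m g \<xi>)
      = ip (space V m) (ap_class k m f) (ap_class k m g)"
    if f: "f \<in> eig m" and g: "g \<in> eig m" for f g m
  proof -
    note f' = eig_AP[OF f] and g' = eig_AP[OF g]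
    define h where "h = ap_adj g \<circ>\<^sub>A f"
    define c where "c = Poly_Mapping.lookup h (Id_on {1..k})"
    have h: "h \<in> eig k" unfolding h_def by (rule eig_comp[OF f AP_adj[OF g']])
    have "act U k k h \<xi> = act U k k (c \<odot>\<^bsub>AP k k\<^esub> rot_sum) \<xi>"
      using eig_endo[OF h] AP_smult[OF rot_sum_AP, of c]
      unfolding c_def AP_simps(4) by (intro act_cong[OF low \<xi> eig_AP[OF h]]) auto
    also have "\<dots> = c \<odot>\<^bsub>space U k\<^esub> (of_nat (max 1 k) \<odot>\<^bsub>space U k\<^esub> \<xi>)"
      by (simp only: act_smult[OF rot_sum_AP \<xi>] fixed)
    finally have act_h: "act U k k h \<xi> = c \<odot>\<^bsub>space U k\<^esub> (of_nat (max 1 k) \<odot>\<^bsub>space U k\<^esub> \<xi>)" .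
    have "ip (space U m) (act U k m f \<xi>) (act U k m g \<xi>) = ip (space U k) (act U k k h \<xi>) \<xi>"
      using act_adj[OF AP_adj[OF g'] act_closed[OF f' \<xi>] \<xi>] act_comp[OF f' AP_adj[OF g'] \<xi>]
      by (simp add: h_def)
    also have "\<dots> = c * rot_trace"
      unfolding act_h using \<xi> norm H.smult_closed[of "of_nat (max 1 k)" \<xi>]
      by (simp add: H.ip_smult del: of_nat_max)
    also have "\<dots> = trace_form k tr f g"
      using tr_eig[OF h] by (simp add: trace_form_def ap_class_def h_def c_def)
    finally show ?thesis by (simp add: ip_V[OF f g])
  qed
  \<comment> \<open>The representative is chosen arbitrarily; by \<open>act_cong\<close> the value
    does not depend on it.\<close>
  define \<Phi> where "\<Phi> m X = act U k m (SOME f. f \<in> eig m \<and> X = ap_class k m f) \<xi>" for m X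
  have \<Phi>: "\<Phi> m (ap_class k m f) = act U k m f \<xi>" if f: "f \<in> eig m" for m f
  proof -
    define g where "g = (SOME g. g \<in> eig m \<and> ap_class k m f = ap_class k m g)"
    have g: "g \<in> eig m" "ap_class k m f = ap_class k m g"
      unfolding g_def using someI[of "\<lambda>g. g \<in> eig m \<and> ap_class k m f = ap_class k m g" f] f by auto
    have "ap_cong k m g f"
      using g(2) ap_class_eq_iff[OF eig_AP[OF g(1)] eig_AP[OF f]] by simp
    from act_cong[OF low \<xi> eig_AP[OF g(1)] eig_AP[OF f] this]
    show ?thesis by (simp add: \<Phi>_def g_def)
  qed
  have closed: "\<Phi> m (ap_class k m f) \<in> carrier (space U m)" if "f \<in> eig m" for m f
    using act_closed[OF eig_AP[OF that] \<xi>] by (simp add: \<Phi>[OF that])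
  have add: "\<Phi> m (ap_class k m (f + g)) = \<Phi> m (ap_class k m f) \<oplus>\<^bsub>space U m\<^esub> \<Phi> m (ap_class k m g)"
    if "f \<in> eig m" "g \<in> eig m" for m f g
    using act_add[OF eig_AP[OF that(1)] eig_AP[OF that(2)] \<xi>]
    by (simp add: \<Phi>[OF that(1)] \<Phi>[OF that(2)] \<Phi>[OF eig_add[OF that]])
  have smult: "\<Phi> m (ap_class k m (ap_smult c f)) = c \<odot>\<^bsub>space U m\<^esub> \<Phi> m (ap_class k m f)"
    if "f \<in> eig m" for m f c
    using act_smult[OF eig_AP[OF that] \<xi>]
    by (simp add: \<Phi>[OF that] \<Phi>[OF eig_smult[OF that]])
  have natural: "\<Phi> n (ap_class k n (a \<circ>\<^sub>A f)) = act U m n a (\<Phi> m (ap_class k m f))"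
    if "a \<in> carrier (AP m n)" "f \<in> eig m" for m n a f
    using act_comp[OF eig_AP[OF that(2)] that(1) \<xi>]
    by (simp add: \<Phi>[OF that(2)] \<Phi>[OF eig_comp[OF that(2) that(1)]])
  \<comment> \<open>The image will turn out to be a nonzero submodule, hence everything.\<close>
  define W where "W m = \<Phi> m ` carrier (space V m)" for m
  have W: "W m = (\<lambda>f. \<Phi> m (ap_class k m f)) ` eig m" for m
    by (auto simp: W_def carrier_V)
  have "ap_submodule W U"
    unfolding ap_submodule_def
  proof (intro conjI allI ballI)
    fix n
    have smult_W: "c \<odot>\<^bsub>space U n\<^esub> y \<in> W n" if "y \<in> W n" for c y
      using that smult eig_smult unfolding W by (auto simp: image_iff) metis
    show "submodule (W n) complex_ring (space U n)"
    proof (rule H.submoduleI)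
      show W_sub: "W n \<subseteq> carrier (space U n)" unfolding W using closed by blast
      have "\<zero>\<^bsub>space U n\<^esub> = \<Phi> n (ap_class k n 0)" by (simp add: \<Phi>[OF eig_zero] act_zero[OF \<xi>])
      then show "\<zero>\<^bsub>space U n\<^esub> \<in> W n" unfolding W using eig_zero by blast
      show "\<ominus>\<^bsub>space U n\<^esub> y \<in> W n" if y: "y \<in> W n" for y
      proof -
        have "y \<in> carrier (space U n)" using y W_sub by blast
        then have "\<ominus>\<^bsub>space U n\<^esub> y = (\<ominus>\<^bsub>complex_ring\<^esub> 1) \<odot>\<^bsub>space U n\<^esub> y"
          using H.smult_l_minus[of 1 y] H.smult_one[of y] by simp
        then show ?thesis using smult_W[OF y] by simp
      qed
      show "y \<oplus>\<^bsub>space U n\<^esub> z \<in> W n" if "y \<in> W n" "z \<in> W n" for y z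
        using that add eig_add unfolding W by (auto simp: image_iff) metis
      show "c \<odot>\<^bsub>space U n\<^esub> y \<in> W n" if "y \<in> W n" for c y
        using smult_W[OF that] .
    qed
  next
    fix m n a x assume "a \<in> carrier (AP m n)" "x \<in> W m"
    then show "act U m n a x \<in> W n"
      using natural eig_comp unfolding W by (auto simp: image_iff) metis
  qed
  \<comment> \<open>The class of \<open>rot_sum\<close> has nonzero norm, which the isometry
    preserves.\<close>
  moreover have "\<Phi> k (ap_class k k rot_sum) \<noteq> \<zero>\<^bsub>space U k\<^esub>"
  proof
    assume 0: "\<Phi> k (ap_class k k rot_sum) = \<zero>\<^bsub>space U k\<^esub>"
    have "ip (space V k) (ap_class k k rot_sum) (ap_class k k rot_sum) = 0"
      using isom[OF rot_sum_eig rot_sum_eig] 0 \<Phi>[OF rot_sum_eig]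
        H.ip_smult[of "\<zero>\<^bsub>space U k\<^esub>" k "\<zero>\<^bsub>space U k\<^esub>" 0] H.smult_l_null[of "\<zero>\<^bsub>space U k\<^esub>" k] by simp
    then show False
      using rot_sum_nonzero_V fd_hilbert_space.ip_definite[OF fd_hilbert_space_V class_V[OF rot_sum_eig]]
      by blast
  qed
  then have "W k \<noteq> {\<zero>\<^bsub>space U k\<^esub>}" unfolding W using rot_sum_eig by blast
  ultimately have surj: "W m = carrier (space U m)" for m
    using irr unfolding irreducible_ap_module_def by blast
  have "inj_on (\<Phi> m) (carrier (space V m))" for m
  proof (rule inj_onI)
    fix X Y assume "X \<in> carrier (space V m)" "Y \<in> carrier (space V m)" and eq: "\<Phi> m X = \<Phi> m Y"
    then obtain f g where f: "f \<in> eig m" "X = ap_class k m f" and g: "g \<in> eig m" "Y = ap_class k m g"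
      by (auto simp: carrier_V)
    \<comment> \<open>The difference of the representatives, written with a scalar so that the
      closure properties of \<open>eig\<close> apply. Its class is sent to zero, so by isometry it
      has norm zero.\<close>
    define h where "h = f + ap_smult (- 1) g"
    have h: "h \<in> eig m" unfolding h_def by (rule eig_add[OF f(1) eig_smult[OF g(1)]])
    have fhg: "f = h + g"
      unfolding h_def by (rule poly_mapping_eqI) (simp add: lookup_add)
    have "\<Phi> m (ap_class k m g) = \<Phi> m (ap_class k m h) \<oplus>\<^bsub>space U m\<^esub> \<Phi> m (ap_class k m g)"
      using eq add[OF h g(1)] by (simp add: f(2) g(2) fhg[symmetric])
    then have 0: "act U k m h \<xi> = \<zero>\<^bsub>space U m\<^esub>"
      using closed[OF h] closed[OF g(1)] \<Phi>[OF h] H.add.r_cancel_one' by metis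
    have "ip (space V m) (ap_class k m h) (ap_class k m h) = 0"
      using isom[OF h h] 0
        H.ip_smult[of "\<zero>\<^bsub>space U m\<^esub>" m "\<zero>\<^bsub>space U m\<^esub>" 0] H.smult_l_null[of "\<zero>\<^bsub>space U m\<^esub>" m] by simp
    then have "ap_class k m h = ap_class k m 0"
      using fd_hilbert_space.ip_definite[OF fd_hilbert_space_V class_V[OF h]] by (simp add: zero_V)
    then have "ap_cong k m h 0" using ap_class_eq_iff[OF eig_AP[OF h] AP_zero] by blast
    then have "ap_cong k m f g" unfolding fhg by (simp add: ap_cong_def lookup_add)
    then show "X = Y" using ap_class_eq_iff[OF eig_AP[OF f(1)] eig_AP[OF g(1)]] f(2) g(2) by blast
  qed
  then have bij: "bij_betw (\<Phi> m) (carrier (space V m)) (carrier (space U m))" for m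
    using surj[of m] by (simp add: bij_betw_def W_def)
  have "\<Phi> m \<in> unitaries (space V m) (space U m)" for m
    unfolding unitaries_def linear_maps_def using bij
    by (auto simp: carrier_V add_V smult_V add smult isom \<Phi> act_closed[OF eig_AP \<xi>])
  moreover have "\<Phi> n (act V m n a X) = act U m n a (\<Phi> m X)"
    if "a \<in> carrier (AP m n)" "X \<in> carrier (space V m)" for m n a X
    using that by (auto simp: carrier_V act_V[OF eig_AP] natural)
  ultimately show ?thesis unfolding ap_module_iso_def by blast
qed

end

section \<open>Classification by weight and eigenvalue\<close>

text \<open>Some eigenprojection does not kill a given nonzero vector of the weight space; the image
  is rescaled until it meets the hypotheses of \<open>ap_module_iso_from_V\<close>.\<close>

lemma irreducible_ap_module_classification:
  fixes U :: "'v ap_module"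
  assumes tr: "faithful_trace k tr" and irr: "irreducible_ap_module U" and weight: "weight U = k"
  obtains \<omega> where "rotation_eigenvalue k \<omega>" "ap_module_iso U (Vmod k \<omega> tr)"
proof -
  interpret hilbert_ap_module U using irr by (simp add: irreducible_ap_module_def)
  interpret H: fd_hilbert_space "space U n" for n by (rule hilbert)
  have low: "carrier (space U j) = {\<zero>\<^bsub>space U j\<^esub>}" if "j < k" for j
    using not_less_Least[of j] that weight unfolding weight_def by blast
  have "carrier (space U k) \<noteq> {\<zero>\<^bsub>space U k\<^esub>}"
    using irr weight LeastI_ex[of "\<lambda>n. carrier (space U n) \<noteq> {\<zero>\<^bsub>space U n\<^esub>}"]
    unfolding weight_def irreducible_ap_module_def by blast
  then obtain x where x: "x \<in> carrier (space U k)" "x \<noteq> \<zero>\<^bsub>space U k\<^esub>"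
    using H.zero_closed[of k] by blast
  obtain \<omega> where eigenvalue: "rotation_eigenvalue k \<omega>"
    and nz: "act U k k (rotation_eigenvalue.rot_sum k \<omega>) x \<noteq> \<zero>\<^bsub>space U k\<^esub>"
    by (rule exists_rotation_eigenvalue[OF x])
  interpret traced_rotation_eigenvalue k \<omega> tr
    using eigenvalue tr by (simp add: traced_rotation_eigenvalue_def traced_rotation_eigenvalue_axioms_def)
  define N :: nat where "N = max 1 k"
  define y where "y = act U k k rot_sum x"
  have y: "y \<in> carrier (space U k)" unfolding y_def by (rule act_closed[OF rot_sum_AP x(1)])
  \<comment> \<open>Modulo lower tangles \<open>rot_sum\<close> composed with itself is
    \<open>N\<close> times \<open>rot_sum\<close>, so it multiplies its image \<open>y\<close> by
    \<open>N\<close>.\<close>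
  have "act U k k rot_sum y = act U k k (rot_sum \<circ>\<^sub>A rot_sum) x"
    unfolding y_def by (rule act_comp[OF rot_sum_AP rot_sum_AP x(1), symmetric])
  also have "\<dots> = act U k k (of_nat N \<odot>\<^bsub>AP k k\<^esub> rot_sum) x"
    using eig_comp_rot_sum[OF rot_sum_eig] unfolding N_def AP_simps(4)
    by (intro act_cong[OF low x(1) AP_comp[OF rot_sum_AP rot_sum_AP] AP_smult[OF rot_sum_AP]])
  also have "\<dots> = of_nat N \<odot>\<^bsub>space U k\<^esub> y"
    unfolding y_def by (rule act_smult[OF rot_sum_AP x(1)])
  finally have fixed: "act U k k rot_sum y = of_nat N \<odot>\<^bsub>space U k\<^esub> y" .
  obtain w where w: "w > 0" "rot_trace = of_real w" by (rule rot_trace_pos)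
  obtain p where p: "ip (space U k) y y = of_real p" "p \<ge> 0"
    using H.ip_nonneg[OF y] by (auto elim: nonneg_Reals_cases)
  have "p \<noteq> 0" using H.ip_definite[OF y] nz p(1) by (auto simp: y_def)
  then have p0: "p > 0" using p(2) by simp
  have N: "N > 0" by (simp add: N_def)
  \<comment> \<open>As \<open>p\<close> is the squared norm of \<open>y\<close>, this is the scaling
    for which \<open>N\<close> times the squared norm of \<xi> becomes \<open>w\<close>.\<close>
  define c where "c = sqrt (w / (real N * p))"
  define \<xi> where "\<xi> = of_real c \<odot>\<^bsub>space U k\<^esub> y"
  have \<xi>: "\<xi> \<in> carrier (space U k)" unfolding \<xi>_def using y by simp
  have "act U k k rot_sum \<xi> = of_real c \<odot>\<^bsub>space U k\<^esub> (of_nat N \<odot>\<^bsub>space U k\<^esub> y)"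
    unfolding \<xi>_def act_smult_vector[OF rot_sum_AP y] fixed ..
  also have "\<dots> = of_nat N \<odot>\<^bsub>space U k\<^esub> \<xi>"
    unfolding \<xi>_def using y
      H.smult_assoc1[of "of_real c" "of_nat N" y] H.smult_assoc1[of "of_nat N" "of_real c" y]
    by (simp add: mult.commute)
  finally have fixed_\<xi>: "act U k k rot_sum \<xi> = of_nat N \<odot>\<^bsub>space U k\<^esub> \<xi>" .
  have "ip (space U k) \<xi> \<xi> = of_real c * ip (space U k) y \<xi>"
    unfolding \<xi>_def using y by (intro H.ip_smult) auto
  also have "ip (space U k) y \<xi> = cnj (ip (space U k) \<xi> y)"
    by (rule H.ip_cnj[OF \<xi> y])
  also have "\<dots> = of_real (c * p)"
    unfolding \<xi>_def H.ip_smult[OF y y] p(1) by simp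
  finally have "of_nat N * ip (space U k) \<xi> \<xi> = of_real (real N * (c * c * p))"
    by (simp add: mult.assoc)
  also have "real N * (c * c * p) = w"
    using w(1) p0 N by (simp add: c_def)
  finally have "of_nat N * ip (space U k) \<xi> \<xi> = rot_trace" by (simp add: w(2))
  then have "ap_module_iso V U"
    using \<xi> fixed_\<xi> unfolding N_def by (intro ap_module_iso_from_V[OF irr low]) auto
  then have "ap_module_iso U V" by (rule ap_module_iso_sym[OF hilbert_ap_module_V])
  then show thesis using that eigenvalue by blast
qed

theorem proposition4p32:
  fixes k :: nat and tr :: "ap set \<Rightarrow> complex"
  assumes "faithful_trace k tr"
  shows "(\<forall>\<omega>. \<omega> ^ k = 1 \<and> (k = 0 \<longrightarrow> \<omega> = 1) \<longrightarrow>
            irreducible_ap_module (Vmod k \<omega> tr) \<and> weight (Vmod k \<omega> tr) = k) \<and>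
         (\<forall>V :: 'v ap_module. irreducible_ap_module V \<and> weight V = k \<longrightarrow>
            (\<exists>\<omega>. \<omega> ^ k = 1 \<and> (k = 0 \<longrightarrow> \<omega> = 1) \<and> ap_module_iso V (Vmod k \<omega> tr)))"
proof -
  \<comment> \<open>For \<open>k = 0\<close> the equation \<open>\<omega> ^ k = 1\<close> says
    nothing and \<omega> = 1 is asked separately; the exponent \<open>max 1 k\<close> merges the two
    cases.\<close>
  have root_iff: "rotation_eigenvalue k \<omega> \<longleftrightarrow> \<omega> ^ k = 1 \<and> (k = 0 \<longrightarrow> \<omega> = 1)" for \<omega>
    by (cases "k = 0") (auto simp: rotation_eigenvalue_def max_def)
  have "irreducible_ap_module (Vmod k \<omega> tr) \<and> weight (Vmod k \<omega> tr) = k"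
    if "rotation_eigenvalue k \<omega>" for \<omega>
  proof -
    interpret traced_rotation_eigenvalue k \<omega> tr
      using that assms
      by (simp add: traced_rotation_eigenvalue_def traced_rotation_eigenvalue_axioms_def)
    show ?thesis using irreducible_V weight_V by blast
  qed
  moreover have "\<exists>\<omega>. rotation_eigenvalue k \<omega> \<and> ap_module_iso V (Vmod k \<omega> tr)"
    if "irreducible_ap_module V" "weight V = k" for V :: "'v ap_module"
    using irreducible_ap_module_classification[OF assms that] by blast
  ultimately show ?thesis unfolding root_iff by blast
qed

end
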